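(* Let $\lambda>0$, $\delta>0$, $\gamma\ge 0$. Let $N$ be a Poisson process with rate $\lambda$, $p_k(x)=\mathbb{P}(N(x)=k)$, and let $H$ be the first hitting time process of the inverse Gaussian subordinator with parameters $\delta,\gamma$, independent of $N$. Let $h(x,t)$, $x>0$, be the density of $H(t)$ and $h(0,t)=\lim_{x\to0+}h(x,t)$. For integers $k\ge 0$ let $\tilde p_k(t)=\mathbb{P}(N(H(t))=k)$, and set $\tilde p_{-1}=\tilde p_{-2}\equiv 0$. Then for every $k\ge0$ and $t>0$, $$\frac{d}{dt}\tilde p_k(t)=\frac{1}{2\delta^2}\Big[(\lambda^2-2\delta\gamma\lambda)\tilde p_k(t)+(-2\lambda^2+2\delta\gamma\lambda)\tilde p_{k-1}(t)+\lambda^2\tilde p_{k-2}(t)\Big]-\delta_0(t)\tilde p_k(0)+\frac{1}{2\delta^2}h(0,t)\,p_k'(0),$$ where $p_k'(0)=-\lambda$ for $k=0$, $p_k'(0)=\lambda$ for $k=1$, and $p_k'(0)=0$ for $k\ge2$.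
   Context: The inverse Gaussian subordinator is $G(t)=\inf\{s>0:\ B(s)+\gamma s>\delta t\}$, with $B$ a standard Brownian motion; $\mathbb{E}[e^{-sG(t)}]=\exp(-t\delta(\sqrt{\gamma^2+2s}-\gamma))$. Its first hitting time process is $H(t)=\inf\{s\ge0:\ G(s)>t\}$. The Poisson process has $p_k(x)=e^{-\lambda x}(\lambda x)^k/k!$. $\delta_0(t)$ denotes the Dirac delta at $t=0$ (so this term is zero at every $t>0$); it is unrelated to the parameter $\delta$. *)

theory Defs
  imports "HOL-Probability.Probability"
begin

text \<open>
  A continuous-time process is a function \<open>X :: real \<Rightarrow> 'a \<Rightarrow> 'b\<close> (time first); only the times
  \<open>t \<ge> 0\<close> are relevant.
\<close>

definition (in prob_space) indep_increments :: "(real \<Rightarrow> 'a \<Rightarrow> real) \<Rightarrow> bool" where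
  "indep_increments X \<longleftrightarrow>
     (\<forall>(n::nat) (ts::nat \<Rightarrow> real). 0 \<le> ts 0 \<and> mono_on {..n} ts \<longrightarrow>
        indep_vars (\<lambda>_. borel) (\<lambda>i \<omega>. X (ts (Suc i)) \<omega> - X (ts i) \<omega>) {..<n})"

text \<open>
  Path regularity is required of every path rather than almost every one, so that the hitting
  times below and \<open>N (H t)\<close> are measurable without completing the probability space.
\<close>

definition (in prob_space) standard_brownian_motion :: "(real \<Rightarrow> 'a \<Rightarrow> real) \<Rightarrow> bool" where
  "standard_brownian_motion B \<longleftrightarrow>
     (\<forall>t\<ge>0. random_variable borel (B t)) \<and>
     (AE \<omega> in M. B 0 \<omega> = 0) \<and>
     indep_increments B \<and>
     (\<forall>s t. 0 \<le> s \<and> s < t \<longrightarrow>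
        distributed M lborel (\<lambda>\<omega>. B t \<omega> - B s \<omega>) (normal_density 0 (sqrt (t - s)))) \<and>
     (\<forall>\<omega>\<in>space M. continuous_on {0..} (\<lambda>t. B t \<omega>))"

text \<open>
  Left limits of the paths exist automatically, since a monotone \<open>nat\<close>-valued path is bounded on
  bounded time intervals.
\<close>

definition (in prob_space) poisson_process :: "real \<Rightarrow> (real \<Rightarrow> 'a \<Rightarrow> nat) \<Rightarrow> bool" where
  "poisson_process rate N \<longleftrightarrow>
     (\<forall>t\<ge>0. random_variable (count_space UNIV) (N t)) \<and>
     (AE \<omega> in M. N 0 \<omega> = 0) \<and>
     indep_increments (\<lambda>t \<omega>. real (N t \<omega>)) \<and>
     (\<forall>s t. 0 \<le> s \<and> s < t \<longrightarrow>
        distr M (count_space UNIV) (\<lambda>\<omega>. N t \<omega> - N s \<omega>)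
          = measure_pmf (poisson_pmf (rate * (t - s)))) \<and>
     (\<forall>\<omega>\<in>space M. mono_on {0..} (\<lambda>t. N t \<omega>) \<and>
        (\<forall>t\<ge>0. continuous (at_right t) (\<lambda>s. N s \<omega>)))"

text \<open>
  The value is extended real because the level need not be reached on every path (infimum of the
  empty set being \<open>\<infinity>\<close>).
\<close>

definition inverse_gaussian_subordinator ::
    "real \<Rightarrow> real \<Rightarrow> (real \<Rightarrow> 'a \<Rightarrow> real) \<Rightarrow> real \<Rightarrow> 'a \<Rightarrow> ereal" where
  "inverse_gaussian_subordinator \<delta> \<gamma> B t \<omega> =
     Inf {ereal s | s. 0 < s \<and> B s \<omega> + \<gamma> * s > \<delta> * t}"

text \<open>
  For the inverse Gaussian subordinator with \<open>\<delta> > 0\<close> and \<open>t \<ge> 0\<close> the set below is never empty: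
  a continuous path of \<open>B\<close> is bounded on bounded intervals, hence \<open>G s > t\<close> for large \<open>s\<close>.
  So the real infimum is the intended one.
\<close>

definition first_hitting_time :: "(real \<Rightarrow> 'a \<Rightarrow> ereal) \<Rightarrow> real \<Rightarrow> 'a \<Rightarrow> real" where
  "first_hitting_time G t \<omega> = Inf {s. 0 \<le> s \<and> G s \<omega> > ereal t}"

text \<open>
  Independence of the two processes as wholes, i.e. as random elements of the path space over
  \<open>{0..}\<close> with its product \<open>\<sigma>\<close>-algebra.
\<close>

definition (in prob_space) indep_processes ::
    "(real \<Rightarrow> 'a \<Rightarrow> real) \<Rightarrow> (real \<Rightarrow> 'a \<Rightarrow> real) \<Rightarrow> bool" where
  "indep_processes X Y \<longleftrightarrow>
     indep_var (PiM {0..} (\<lambda>_. borel)) (\<lambda>\<omega>. \<lambda>t\<in>{0..}. X t \<omega>)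
               (PiM {0..} (\<lambda>_. borel)) (\<lambda>\<omega>. \<lambda>t\<in>{0..}. Y t \<omega>)"

text \<open>
  The density is only determined up to null sets; its continuous version on \<open>{0<..}\<close> is the one
  for which a limit at \<open>0\<close> is meaningful. The values \<open>f x\<close> for \<open>x \<le> 0\<close> are irrelevant.
\<close>

definition (in prob_space) has_continuous_density_on_pos ::
    "('a \<Rightarrow> real) \<Rightarrow> (real \<Rightarrow> real) \<Rightarrow> bool" where
  "has_continuous_density_on_pos X f \<longleftrightarrow>
     distributed M lborel X (\<lambda>x. ennreal (indicator {0<..} x * f x)) \<and>
     (\<forall>x>0. 0 \<le> f x) \<and> continuous_on {0<..} f"

definition (in prob_space) poisson_prob :: "(real \<Rightarrow> 'a \<Rightarrow> nat) \<Rightarrow> nat \<Rightarrow> real \<Rightarrow> real" where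
  "poisson_prob N k x = prob {\<omega> \<in> space M. N x \<omega> = k}"

text \<open>The index is an integer so that the convention for \<open>k = -1\<close> and \<open>k = -2\<close> makes sense.\<close>

definition (in prob_space) subordinated_prob ::
    "(real \<Rightarrow> 'a \<Rightarrow> nat) \<Rightarrow> (real \<Rightarrow> 'a \<Rightarrow> real) \<Rightarrow> int \<Rightarrow> real \<Rightarrow> real" where
  "subordinated_prob N H k t =
     (if k < 0 then 0 else prob {\<omega> \<in> space M. int (N (H t \<omega>) \<omega>) = k})"

text \<open>
  The Dirac delta at \<open>0\<close>, as a function of time off its support: it vanishes for \<open>t \<noteq> 0\<close>, and it
  has no (finite) value at \<open>t = 0\<close>, where it is never evaluated.
\<close>

definition dirac_delta0 :: "real \<Rightarrow> real" where
  "dirac_delta0 t = (if t = 0 then undefined else 0)"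

end

theory Submission
  imports Defs "HOL-Real_Asymp.Real_Asymp"
begin

text \<open>
  The hitting time \<open>H(t)\<close> is \<open>1/\<delta>\<close> times the maximum over \<open>[0, t]\<close> of \<open>X(s) = B(s) + \<gamma> s\<close>. Combining the
  reflection principle with an exponential tilt gives \<open>P(max X \<ge> m) = E w(m - X(t))\<close>, where
  \<open>w(y) = (1 + exp (2 \<gamma> y)) 1(y \<le> 0)\<close>: once \<open>X\<close> is at the level \<open>m\<close>, the conditional expectation of
  \<open>w(m - X(t))\<close> is \<open>1\<close>. The strong Markov property is avoided by stopping on finite grids, where the
  overshoot only costs inequalities in the right directions, and letting the mesh tend to \<open>0\<close>.
  The resulting density of \<open>H(t)\<close> is smooth up to \<open>x = 0\<close> and solves a Fokker-Planck equation with
  reflection at the origin; integrating it against \<open>p\<^sub>k\<close>, whose derivatives are combinations of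
  \<open>p\<^sub>k\<close>, \<open>p\<^sub>k\<^sub>-\<^sub>1\<close>, \<open>p\<^sub>k\<^sub>-\<^sub>2\<close>, yields the equation.
\<close>

text \<open>The weight \<open>w\<close> comes from comparing drifts. For a Gaussian increment
  \<open>v\<close> with mean \<open>\<gamma> * t\<close> and variance \<open>t\<close>, the factor
  \<open>exp (- 2 * \<gamma> * v)\<close> is the likelihood ratio of drift \<open>- \<gamma>\<close>
  against drift \<open>\<gamma>\<close>, so the mean of \<open>w(- v)\<close> is
  \<open>P(v \<ge> 0) + P(v \<le> 0) = 1\<close>; for \<open>\<gamma> = 0\<close> this is the usual
  factor 2. With remaining time \<open>s\<close> and distance \<open>y\<close> to the level, the
  same mean is the closed formula \<open>drifted_max_tail \<gamma> y s\<close>. It is at least 1 for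
  \<open>y \<le> 0\<close> and at most 1 for \<open>y \<ge> 0\<close>, and these two signs are the
  directions that the overshoot requires. The density is never differentiated in time. One
  integration by parts puts the tail in its place; the time derivative of the tail is the first
  passage density \<open>p\<close>, which is bounded uniformly in space; and the relation
  \<open>q_y = 2 * \<gamma> * q - 2 * p\<close> with the density \<open>q\<close> of the maximum
  brings \<open>q\<close> back through a second integration by parts. The density in the theorem is
  given, not constructed. It is identified at every positive point by differentiating the tail, so
  its limit at 0 can be read off the formula.\<close>

lemma FTC_greaterThan:
  fixes F f :: "real \<Rightarrow> real"
  assumes F: "\<And>x. x > a \<Longrightarrow> (F has_real_derivative f x) (at x)"
    and f: "\<And>x. x > a \<Longrightarrow> isCont f x"
    and int: "set_integrable lborel {a<..} f"
    and A: "(F \<longlongrightarrow> A) (at_right a)" and B: "(F \<longlongrightarrow> B) at_top"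
  shows "(LINT x:{a<..}|lborel. f x) = B - A"
proof -
  have "(LBINT x=ereal a..\<infinity>. f x) = B - A"
  proof (rule interval_integral_FTC_integrable)
    show "(F has_vector_derivative f x) (at x)" if "ereal a < ereal x" for x
      using F[of x] that by (simp add: has_real_derivative_iff_has_vector_derivative)
    show "isCont f x" if "ereal a < ereal x" for x using f that by simp
    show "set_integrable lborel (einterval (ereal a) \<infinity>) f"
      using int by (simp add: einterval_def greaterThan_def)
    show "((F \<circ> real_of_ereal) \<longlongrightarrow> A) (at_right (ereal a))"
      using A by (simp add: ereal_tendsto_simps)
    show "((F \<circ> real_of_ereal) \<longlongrightarrow> B) (at_left \<infinity>)"
      using B by (simp add: ereal_tendsto_simps)
  qed simp
  then show ?thesis
    by (simp add: interval_lebesgue_integral_def einterval_def greaterThan_def)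
qed

subsection \<open>The normal distribution function\<close>

definition std_normal_cdf :: "real \<Rightarrow> real" where
  "std_normal_cdf x = (LINT u:{..x}|lborel. std_normal_density u)"

lemma set_integrable_normal_density [simp]:
  "A \<in> sets borel \<Longrightarrow> 0 < \<sigma> \<Longrightarrow> set_integrable lborel A (normal_density \<mu> \<sigma>)"
  unfolding set_integrable_def by (intro integrable_mult_indicator) auto

lemma DERIV_std_normal_density:
  "(std_normal_density has_real_derivative - x * std_normal_density x) (at x)"
  unfolding std_normal_density_def[abs_def]
  by (auto intro!: derivative_eq_intros simp: field_simps)

lemmas DERIV_std_normal_density' [derivative_intros] = DERIV_chain2[OF DERIV_std_normal_density]

lemma std_normal_cdf_nonneg: "0 \<le> std_normal_cdf x"
  unfolding std_normal_cdf_def set_lebesgue_integral_def by (intro Bochner_Integration.integral_nonneg) auto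

lemma DERIV_std_normal_cdf:
  "(std_normal_cdf has_real_derivative std_normal_density x) (at x)"
proof -
  let ?n = std_normal_density
  \<comment> \<open>Splitting at a base point to the left of \<open>x\<close> leaves an integral
    over a compact interval, where the fundamental theorem of calculus applies; the improper part is
    a constant.\<close>
  define a where "a = x - 1"
  have cont: "continuous_on A ?n" for A
    by (intro continuous_at_imp_continuous_on ballI DERIV_isCont[OF DERIV_std_normal_density])
  have eq: "std_normal_cdf y = std_normal_cdf a + integral {a..y} ?n" if "a \<le> y" for y
  proof -
    have "std_normal_cdf y = (LINT u:{..a} \<union> {a<..y}|lborel. ?n u)"
      using that by (auto simp: std_normal_cdf_def ivl_disj_un)
    also have "\<dots> = std_normal_cdf a + (LINT u:{a<..y}|lborel. ?n u)"
      unfolding std_normal_cdf_def by (intro set_integral_Un) auto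
    also have "(LINT u:{a<..y}|lborel. ?n u) = integral {a<..y} ?n"
      by (intro set_borel_integral_eq_integral) auto
    also have "\<dots> = integral {a..y} ?n"
      by (intro integral_spike_set) (auto intro: negligible_subset[of "{a}"])
    finally show ?thesis .
  qed
  have "((\<lambda>y. std_normal_cdf a + integral {a..y} ?n) has_real_derivative 0 + ?n x)
      (at x within {a..x+1})"
    by (intro derivative_intros integral_has_real_derivative cont) (auto simp: a_def)
  then have "((\<lambda>y. std_normal_cdf a + integral {a..y} ?n) has_real_derivative ?n x) (at x)"
    by (subst (asm) at_within_interior) (auto simp: a_def)
  then show ?thesis
    by (rule has_field_derivative_transform_within_open[where S = "{a<..}"])
       (simp_all add: eq[symmetric, OF less_imp_le], simp add: a_def)
qed

lemmas DERIV_std_normal_cdf' [derivative_intros] = DERIV_chain2[OF DERIV_std_normal_cdf]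

text \<open>The substitution \<open>v = \<mu> - \<sigma> * u\<close> has negative slope, so it
  standardises the law and turns the upper tail into a lower one at once.\<close>

lemma normal_upper_tail:
  assumes "0 < \<sigma>"
  shows "(LINT v:{a..}|lborel. normal_density \<mu> \<sigma> v) = std_normal_cdf ((\<mu> - a) / \<sigma>)"
proof -
  have "(LINT v:{a..}|lborel. normal_density \<mu> \<sigma> v)
      = (\<integral>v. indicator {a..} v * normal_density \<mu> \<sigma> v \<partial>lborel)"
    by (simp add: set_lebesgue_integral_def)
  also have "\<dots> = \<bar>-\<sigma>\<bar> *\<^sub>R (\<integral>u. indicator {a..} (\<mu> + (-\<sigma>) * u) * normal_density \<mu> \<sigma> (\<mu> + (-\<sigma>) * u) \<partial>lborel)"
    by (rule lborel_integral_real_affine) (use assms in auto)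
  also have "\<dots> = (\<integral>u. \<bar>-\<sigma>\<bar> *\<^sub>R (indicator {a..} (\<mu> + (-\<sigma>) * u) * normal_density \<mu> \<sigma> (\<mu> + (-\<sigma>) * u)) \<partial>lborel)"
    by (rule integral_scaleR_right[symmetric])
  also have "\<dots> = (\<integral>u. indicator {..(\<mu> - a) / \<sigma>} u * std_normal_density u \<partial>lborel)"
  proof (intro Bochner_Integration.integral_cong refl)
    fix u
    have "indicator {a..} (\<mu> + (-\<sigma>) * u) = (indicator {..(\<mu> - a) / \<sigma>} u :: real)"
      using assms by (auto simp: indicator_def field_simps)
    moreover have "\<sigma> * normal_density \<mu> \<sigma> (\<mu> + (-\<sigma>) * u) = std_normal_density u"
      using assms by (simp add: normal_density_def real_sqrt_mult power_mult_distrib)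
    ultimately show "\<bar>-\<sigma>\<bar> *\<^sub>R (indicator {a..} (\<mu> + (-\<sigma>) * u) * normal_density \<mu> \<sigma> (\<mu> + (-\<sigma>) * u))
        = indicator {..(\<mu> - a) / \<sigma>} u * std_normal_density u"
      using assms by simp
  qed
  finally show ?thesis by (simp add: std_normal_cdf_def set_lebesgue_integral_def)
qed

lemma std_normal_cdf_minus: "std_normal_cdf (- x) = 1 - std_normal_cdf x"
proof -
  have "std_normal_cdf (- x) = (LINT v:{x..}|lborel. std_normal_density v)"
    by (simp add: normal_upper_tail)
  also have "\<dots> = (LINT v:{x<..}|lborel. std_normal_density v)"
    unfolding set_lebesgue_integral_def
    by (rule integral_cong_AE)
       (use AE_lborel_singleton[of x] in \<open>auto elim!: eventually_mono simp: indicator_def\<close>)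
  finally have "std_normal_cdf x + std_normal_cdf (- x)
      = (LINT v:{..x} \<union> {x<..}|lborel. std_normal_density v)"
    unfolding std_normal_cdf_def by (subst set_integral_Un) auto
  also have "{..x} \<union> {x<..} = UNIV" by auto
  finally show ?thesis by (simp add: set_lebesgue_integral_def)
qed

lemma std_normal_cdf_le_1: "std_normal_cdf x \<le> 1"
  using std_normal_cdf_minus[of x] std_normal_cdf_nonneg[of "- x"] by simp

text \<open>On the tail \<open>u \<ge> z\<close> the constant factor \<open>z\<close> is replaced by
  \<open>u\<close>, and \<open>u\<close> times the normal density has the antiderivative
  \<open>- std_normal_density u\<close>. The bound is what makes \<open>drifted_max_density\<close>
  nonnegative.\<close>

lemma Mills_ratio_bound:
  assumes "0 \<le> z"
  shows "z * std_normal_cdf (- z) \<le> std_normal_density z"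
proof -
  have int: "integrable lborel (\<lambda>u. std_normal_density u * u)"
    using integrable_std_normal_moment[of 1] by simp
  have int': "set_integrable lborel {z<..} (\<lambda>u. std_normal_density u * u)"
    unfolding set_integrable_def by (intro integrable_mult_indicator int) auto
  have "z * std_normal_cdf (- z) = (LINT u:{z..}|lborel. std_normal_density u * z)"
    by (simp add: normal_upper_tail)
  also have "\<dots> = (LINT u:{z<..}|lborel. std_normal_density u * z)"
    unfolding set_lebesgue_integral_def
    by (rule integral_cong_AE)
       (use AE_lborel_singleton[of z] in \<open>auto elim!: eventually_mono simp: indicator_def\<close>)
  also have "\<dots> \<le> (LINT u:{z<..}|lborel. std_normal_density u * u)"
    by (intro set_integral_mono int') (auto intro!: mult_left_mono)
  also have "\<dots> = 0 - (- std_normal_density z)"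
  proof (rule FTC_greaterThan[where F = "\<lambda>u. - std_normal_density u"])
    show "((\<lambda>u. - std_normal_density u) has_real_derivative std_normal_density x * x) (at x)" for x
      by (auto intro!: derivative_eq_intros)
    show "isCont (\<lambda>u. std_normal_density u * u) x" for x
      by (intro continuous_intros DERIV_isCont[OF DERIV_std_normal_density])
    show "((\<lambda>u. - std_normal_density u) \<longlongrightarrow> - std_normal_density z) (at_right z)"
      using DERIV_isCont[OF DERIV_std_normal_density, of z]
      by (intro tendsto_minus) (simp add: isCont_def filterlim_at_split)
    show "((\<lambda>u. - std_normal_density u) \<longlongrightarrow> 0) at_top"
      unfolding std_normal_density_def by real_asymp
  qed (rule int')
  finally show ?thesis by simp
qed

text \<open>
  Tail and density of the maximum over \<open>[0, t]\<close> of a Brownian motion with drift \<open>\<gamma>\<close>, and density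
  at time \<open>t\<close> of its first passage to the level \<open>y\<close>.
\<close>

definition drifted_max_tail :: "real \<Rightarrow> real \<Rightarrow> real \<Rightarrow> real" where
  "drifted_max_tail \<gamma> y t = std_normal_cdf ((\<gamma> * t - y) / sqrt t)
     + exp (2 * \<gamma> * y) * std_normal_cdf (- (y + \<gamma> * t) / sqrt t)"

definition drifted_max_density :: "real \<Rightarrow> real \<Rightarrow> real \<Rightarrow> real" where
  "drifted_max_density \<gamma> y t = 2 * (std_normal_density ((y - \<gamma> * t) / sqrt t) / sqrt t)
     - 2 * \<gamma> * exp (2 * \<gamma> * y) * std_normal_cdf (- (y + \<gamma> * t) / sqrt t)"

definition first_passage_density :: "real \<Rightarrow> real \<Rightarrow> real \<Rightarrow> real" where
  "first_passage_density \<gamma> y t = y / t * (std_normal_density ((y - \<gamma> * t) / sqrt t) / sqrt t)"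

text \<open>The squares of \<open>y + \<gamma> * t\<close> and \<open>y - \<gamma> * t\<close>
  differ by \<open>4 * \<gamma> * y * t\<close>. Thanks to this tilt both terms of the tail produce
  the same Gaussian factor whenever they are differentiated.\<close>

lemma std_normal_density_tilt:
  assumes "0 < t"
  shows "exp (2 * \<gamma> * y) * std_normal_density ((y + \<gamma> * t) / sqrt t)
    = std_normal_density ((y - \<gamma> * t) / sqrt t)"
proof -
  have "2 * \<gamma> * y - ((y + \<gamma> * t) / sqrt t)\<^sup>2 / 2 = - ((y - \<gamma> * t) / sqrt t)\<^sup>2 / 2"
    using assms by (simp add: power_divide field_simps power2_eq_square)
  then show ?thesis
    by (simp add: std_normal_density_def exp_add[symmetric] mult.assoc[symmetric] mult.commute
        del: mult_exp_exp) (simp add: mult_exp_exp)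
qed

lemma std_normal_density_tilt':
  assumes "0 < t"
  shows "exp (2 * \<gamma> * y) * std_normal_density (- (y + \<gamma> * t) / sqrt t)
    = std_normal_density ((y - \<gamma> * t) / sqrt t)"
  using std_normal_density_tilt[OF assms, of \<gamma> y]
  by (simp only: minus_divide_left[symmetric] std_normal_density_def power2_minus)

lemma DERIV_exp_std_normal_cdf:
  assumes "0 < t"
  shows "((\<lambda>y. exp (2 * \<gamma> * y) * std_normal_cdf (- (y + \<gamma> * t) / sqrt t)) has_real_derivative
    2 * \<gamma> * exp (2 * \<gamma> * y) * std_normal_cdf (- (y + \<gamma> * t) / sqrt t)
      - std_normal_density ((y - \<gamma> * t) / sqrt t) / sqrt t) (at y)"
proof -
  have "((\<lambda>y. - (y + \<gamma> * t) / r) has_real_derivative - 1 / r) (at y)" for r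
    by (intro DERIV_cdivide) (auto intro!: derivative_eq_intros)
  note d = this[THEN DERIV_std_normal_cdf', of "sqrt t"]
  have e: "((\<lambda>y. exp (2 * \<gamma> * y)) has_real_derivative 2 * \<gamma> * exp (2 * \<gamma> * y)) (at y)"
    by (auto intro!: derivative_eq_intros)
  show ?thesis
    using DERIV_mult[OF e d] unfolding std_normal_density_tilt'[OF assms, of \<gamma> y, symmetric]
    by (simp add: mult_ac)
qed

lemma DERIV_std_normal_affine:
  "((\<lambda>y. std_normal_cdf ((a - y) / r)) has_real_derivative - (std_normal_density ((y - a) / r) / r)) (at y)"
  "((\<lambda>y. std_normal_density ((y - a) / r)) has_real_derivative
     - ((y - a) / r * std_normal_density ((y - a) / r) / r)) (at y)"
proof -
  have "((\<lambda>y. (a - y) / r) has_real_derivative - 1 / r) (at y)"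
    by (intro DERIV_cdivide) (auto intro!: derivative_eq_intros)
  from DERIV_std_normal_cdf'[OF this]
  show "((\<lambda>y. std_normal_cdf ((a - y) / r)) has_real_derivative - (std_normal_density ((y - a) / r) / r)) (at y)"
    by (simp add: std_normal_density_def power_divide power2_commute)
  have "((\<lambda>y. (y - a) / r) has_real_derivative 1 / r) (at y)"
    by (intro DERIV_cdivide) (auto intro!: derivative_eq_intros)
  from DERIV_std_normal_density'[OF this]
  show "((\<lambda>y. std_normal_density ((y - a) / r)) has_real_derivative
     - ((y - a) / r * std_normal_density ((y - a) / r) / r)) (at y)"
    by simp
qed

lemma DERIV_drifted_max_tail_space:
  assumes "0 < t"
  shows "((\<lambda>y. drifted_max_tail \<gamma> y t) has_real_derivative - drifted_max_density \<gamma> y t) (at y)"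
  unfolding drifted_max_tail_def[abs_def] drifted_max_density_def
  using DERIV_add[OF DERIV_std_normal_affine(1)[of "\<gamma> * t" "sqrt t"] DERIV_exp_std_normal_cdf[OF assms, of \<gamma> y]]
  by (rule DERIV_cong) simp

text \<open>Together with the time derivative of the tail \<open>T\<close>, this is the
  Fokker-Planck equation integrated once in space: \<open>T_t = T_yy / 2 - \<gamma> * T_y\<close>.
  As the passage density vanishes at \<open>y = 0\<close>, it also contains the reflecting boundary
  condition there.\<close>

lemma DERIV_drifted_max_density_space:
  assumes "0 < t"
  shows "((\<lambda>y. drifted_max_density \<gamma> y t) has_real_derivative
    2 * \<gamma> * drifted_max_density \<gamma> y t - 2 * first_passage_density \<gamma> y t) (at y)"
proof -
  define E where "E = exp (2 * \<gamma> * y)"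
  define r where "r = sqrt t"
  define n where "n = std_normal_density ((y - \<gamma> * t) / r)"
  define P where "P = std_normal_cdf (- (y + \<gamma> * t) / r)"
  \<comment> \<open>Writing \<open>t\<close> as \<open>r * r\<close> makes the final identity
    rational in \<open>r\<close>, so that it falls to \<open>field_simps\<close>.\<close>
  have r: "r > 0" "t = r * r" using assms by (auto simp: r_def)
  have "((\<lambda>y. drifted_max_density \<gamma> y t) has_real_derivative
      2 * (- ((y - \<gamma> * t) / r * n / r) / r) - 2 * \<gamma> * (2 * \<gamma> * E * P - n / r)) (at y)"
    unfolding drifted_max_density_def[abs_def] E_def n_def P_def r_def mult.assoc[of "2 * \<gamma>"]
    using DERIV_exp_std_normal_cdf[OF assms, of \<gamma> y, unfolded mult.assoc[of "2 * \<gamma>"]]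
    by (intro DERIV_diff DERIV_cmult DERIV_cdivide DERIV_std_normal_affine(2))
  then show ?thesis
  proof (rule DERIV_cong)
    show "2 * (- ((y - \<gamma> * t) / r * n / r) / r) - 2 * \<gamma> * (2 * \<gamma> * E * P - n / r)
      = 2 * \<gamma> * drifted_max_density \<gamma> y t - 2 * first_passage_density \<gamma> y t"
      unfolding drifted_max_density_def first_passage_density_def
        r_def[symmetric] n_def[symmetric] P_def[symmetric] E_def[symmetric]
      unfolding r(2) using r(1) by (simp add: field_simps)
  qed
qed

text \<open>By the tilt both terms contribute the common Gaussian factor \<open>n\<close>, and the
  numerators \<open>\<gamma> * t + y\<close> and \<open>y - \<gamma> * t\<close> add up to
  \<open>2 * y\<close>. Probabilistically, the maximum over \<open>[0, t]\<close> reaches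
  \<open>y\<close> exactly when the passage time is at most \<open>t\<close>.\<close>

lemma DERIV_drifted_max_tail_time:
  assumes "0 < t"
  shows "((\<lambda>t. drifted_max_tail \<gamma> y t) has_real_derivative first_passage_density \<gamma> y t) (at t)"
proof -
  define E where "E = exp (2 * \<gamma> * y)"
  define r where "r = sqrt t"
  define n where "n = std_normal_density ((y - \<gamma> * t) / sqrt t)"
  have r: "r > 0" "t = r * r" using assms by (auto simp: r_def)
  have n: "std_normal_density ((\<gamma> * t - y) / sqrt t) = n"
    by (simp add: n_def std_normal_density_def power_divide power2_commute)
  have En: "E * std_normal_density (- (y + \<gamma> * t) / sqrt t) = n"
    using std_normal_density_tilt'[OF assms] by (simp add: n_def E_def)
  have s: "(sqrt has_real_derivative 1 / (2 * r)) (at t)"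
    using DERIV_real_sqrt[OF assms] by (simp add: r_def field_simps)
  have d: "((\<lambda>t. (a * t + b) / sqrt t) has_real_derivative (a * t - b) / (2 * t * r)) (at t)" for a b
  proof -
    have "((\<lambda>t. (a * t + b) / sqrt t) has_real_derivative
        (a * sqrt t - (a * t + b) * (1 / (2 * r))) / (sqrt t * sqrt t)) (at t)"
      using r(1) by (intro DERIV_divide s) (auto intro!: derivative_eq_intros simp: r_def)
    then show ?thesis
    proof (rule DERIV_cong)
      show "(a * sqrt t - (a * t + b) * (1 / (2 * r))) / (sqrt t * sqrt t) = (a * t - b) / (2 * t * r)"
        unfolding r_def[symmetric] unfolding r(2) using r(1) by (simp add: field_simps)
    qed
  qed
  have d1: "((\<lambda>t. (\<gamma> * t - y) / sqrt t) has_real_derivative (\<gamma> * t + y) / (2 * t * r)) (at t)"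
    using d[of \<gamma> "- y"] by simp
  have d2: "((\<lambda>t. - (y + \<gamma> * t) / sqrt t) has_real_derivative (y - \<gamma> * t) / (2 * t * r)) (at t)"
    using d[of "- \<gamma>" "- y"] by (simp add: algebra_simps)
  have "((\<lambda>t. drifted_max_tail \<gamma> y t) has_real_derivative
      n * ((\<gamma> * t + y) / (2 * t * r))
      + E * (std_normal_density (- (y + \<gamma> * t) / sqrt t) * ((y - \<gamma> * t) / (2 * t * r)))) (at t)"
    (is "(_ has_real_derivative ?D) _")
    unfolding drifted_max_tail_def[abs_def] E_def n[symmetric]
    by (intro DERIV_add DERIV_cmult DERIV_std_normal_cdf' d1 d2)
  then show ?thesis
  proof (rule DERIV_cong)
    have "?D = n * ((\<gamma> * t + y) / (2 * t * r)) + n * ((y - \<gamma> * t) / (2 * t * r))"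
      unfolding mult.assoc[symmetric, of E] En ..
    also have "\<dots> = y / t * (n / r)"
      unfolding r(2) using r(1) by (simp add: field_simps)
    finally show "?D = first_passage_density \<gamma> y t"
      by (simp add: first_passage_density_def n_def r_def)
  qed
qed

text \<open>The proof is analytic, because no random variable is yet known to have this density: the
  Mills bound at \<open>z = (y + \<gamma> * t) / sqrt t\<close>, where
  \<open>\<gamma> * sqrt t \<le> z\<close>, controls the cdf term, and the tilt rewrites the
  result.\<close>

lemma drifted_max_density_nonneg:
  assumes "0 < t" "0 \<le> \<gamma>" "0 \<le> y"
  shows "0 \<le> drifted_max_density \<gamma> y t"
proof -
  define z where "z = (y + \<gamma> * t) / sqrt t"
  have "\<gamma> * sqrt t \<le> z"
    using assms by (simp add: z_def field_simps)
  then have "\<gamma> * sqrt t * std_normal_cdf (- z) \<le> z * std_normal_cdf (- z)"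
    by (intro mult_right_mono std_normal_cdf_nonneg)
  also have "\<dots> \<le> std_normal_density z"
    using assms by (intro Mills_ratio_bound) (simp add: z_def)
  finally have "\<gamma> * std_normal_cdf (- z) \<le> std_normal_density z / sqrt t"
    using assms by (simp add: field_simps)
  then have "exp (2 * \<gamma> * y) * (\<gamma> * std_normal_cdf (- z))
      \<le> exp (2 * \<gamma> * y) * (std_normal_density z / sqrt t)"
    by (intro mult_left_mono) auto
  also have "\<dots> = std_normal_density ((y - \<gamma> * t) / sqrt t) / sqrt t"
    unfolding times_divide_eq_right z_def std_normal_density_tilt[OF assms(1)] ..
  finally show ?thesis
    by (simp add: drifted_max_density_def z_def minus_divide_left mult_ac)
qed

lemma drifted_max_tail_0: "drifted_max_tail \<gamma> 0 t = 1"
  using std_normal_cdf_minus[of "\<gamma> * t / sqrt t"] by (simp add: drifted_max_tail_def)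

lemma drifted_max_tail_le_1:
  assumes "0 < t" "0 \<le> \<gamma>" "0 \<le> y"
  shows "drifted_max_tail \<gamma> y t \<le> 1"
proof -
  have "drifted_max_tail \<gamma> y t \<le> drifted_max_tail \<gamma> 0 t"
  proof (rule DERIV_nonpos_imp_nonincreasing[OF assms(3)])
    fix x :: real assume "0 \<le> x"
    then show "\<exists>D. ((\<lambda>y. drifted_max_tail \<gamma> y t) has_real_derivative D) (at x) \<and> D \<le> 0"
      using DERIV_drifted_max_tail_space[OF assms(1)] drifted_max_density_nonneg[OF assms(1,2)]
      by (intro exI[of _ "- drifted_max_density \<gamma> x t"]) simp
  qed
  then show ?thesis by (simp add: drifted_max_tail_0)
qed

text \<open>Monotonicity in \<open>y\<close> is no help: for \<open>\<gamma> > 0\<close> and very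
  negative \<open>y\<close>, \<open>drifted_max_density \<gamma> y t\<close> is negative. Negative
  \<open>y\<close> has to be covered because on a grid the process overshoots the level.\<close>

lemma drifted_max_tail_ge_1:
  assumes "0 < t" "0 \<le> \<gamma>" "y \<le> 0"
  shows "1 \<le> drifted_max_tail \<gamma> y t"
proof -
  text \<open>Writing \<open>S\<close> for the tail, \<open>exp (2 \<gamma> z) (S(-z) - 1)\<close> has the density at \<open>z\<close> as its derivative.\<close>
  define G where "G z = std_normal_cdf ((z - \<gamma> * t) / sqrt t)
     - exp (2 * \<gamma> * z) * std_normal_cdf (- (z + \<gamma> * t) / sqrt t)" for z
  have D: "(G has_real_derivative drifted_max_density \<gamma> z t) (at z)" for z
  proof -
    have "std_normal_cdf ((z - \<gamma> * t) / sqrt t) = 1 - std_normal_cdf ((\<gamma> * t - z) / sqrt t)" for z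
      using std_normal_cdf_minus[of "(\<gamma> * t - z) / sqrt t"] by (simp add: minus_divide_left)
    then show ?thesis
      unfolding G_def[abs_def] drifted_max_density_def
      using DERIV_diff[OF DERIV_diff[OF DERIV_const[of 1]
            DERIV_std_normal_affine(1)[of "\<gamma> * t" "sqrt t"]] DERIV_exp_std_normal_cdf[OF assms(1), of \<gamma> z]]
      by simp
  qed
  have "0 \<le> - y" using assms(3) by simp
  then have "G 0 \<le> G (- y)"
  proof (rule DERIV_nonneg_imp_nondecreasing)
    fix x :: real assume "0 \<le> x"
    then show "\<exists>D. (G has_real_derivative D) (at x) \<and> 0 \<le> D"
      using D[of x] drifted_max_density_nonneg[OF assms(1,2)] by blast
  qed
  moreover have "G 0 = 0" by (simp add: G_def)
  ultimately have "0 \<le> exp (2 * \<gamma> * y) * G (- y)" by simp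
  also have "exp (2 * \<gamma> * y) * G (- y) = exp (2 * \<gamma> * y) * std_normal_cdf (- (y + \<gamma> * t) / sqrt t)
       - (exp (2 * \<gamma> * y) * exp (- (2 * \<gamma> * y))) * std_normal_cdf (- ((\<gamma> * t - y) / sqrt t))"
    unfolding G_def right_diff_distrib mult.assoc[symmetric] by (simp add: minus_divide_left)
  also have "\<dots> = drifted_max_tail \<gamma> y t - 1"
    unfolding exp_minus_inverse drifted_max_tail_def std_normal_cdf_minus by simp
  finally show ?thesis by simp
qed

subsection \<open>Evolution of integrals against the density\<close>

lemma has_real_derivative_integral_dominated:
  fixes F F' :: "real \<Rightarrow> 'a \<Rightarrow> real"
  assumes t: "a < t" "t < b"
    and int: "\<And>s. a < s \<Longrightarrow> s < b \<Longrightarrow> integrable M (F s)"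
    and D: "\<And>s x. a < s \<Longrightarrow> s < b \<Longrightarrow> x \<in> space M \<Longrightarrow>
      ((\<lambda>s. F s x) has_real_derivative F' s x) (at s)"
    and bound: "\<And>s x. a < s \<Longrightarrow> s < b \<Longrightarrow> x \<in> space M \<Longrightarrow> \<bar>F' s x\<bar> \<le> w x"
    and w: "integrable M w" and meas [measurable]: "F' t \<in> borel_measurable M"
  shows "((\<lambda>s. \<integral>x. F s x \<partial>M) has_real_derivative (\<integral>x. F' t x \<partial>M)) (at t)"
proof -
  \<comment> \<open>The quotient is cut off to 0 outside \<open>(a, b)\<close>, so that the bound by
    \<open>w\<close> holds along every sequence from its first term on; near \<open>t\<close>
    nothing changes.\<close>
  define q where "q s x = (if a < s \<and> s < b then (F s x - F t x) / (s - t) else 0)" for s x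
  have "((\<lambda>s. \<integral>x. q s x \<partial>M) \<longlongrightarrow> (\<integral>x. F' t x \<partial>M)) (at t)"
    unfolding tendsto_at_iff_sequentially comp_def
  proof (intro allI impI)
    fix X :: "nat \<Rightarrow> real"
    assume X: "\<forall>i. X i \<in> UNIV - {t}" "X \<longlonglongrightarrow> t"
    show "(\<lambda>i. \<integral>x. q (X i) x \<partial>M) \<longlonglongrightarrow> (\<integral>x. F' t x \<partial>M)"
    proof (rule integral_dominated_convergence[OF meas _ w])
      show "q (X i) \<in> borel_measurable M" for i
        using int[of "X i"] int[OF t] unfolding q_def[abs_def]
        by (cases "a < X i \<and> X i < b") (auto dest!: borel_measurable_integrable)
      show "AE x in M. norm (q (X i) x) \<le> w x" for i
      proof (rule AE_I2)
        fix x assume x: "x \<in> space M"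
        show "norm (q (X i) x) \<le> w x"
        proof (cases "a < X i \<and> X i < b")
          case True
          have *: "\<exists>z. a < z \<and> z < b \<and> F (X i) x - F t x = (X i - t) * F' z x"
          proof (cases "t < X i")
            case tx: True
            obtain z where "t < z" "z < X i" "F (X i) x - F t x = (X i - t) * F' z x"
              using MVT2[OF tx, of "\<lambda>s. F s x" "\<lambda>s. F' s x"] D[OF _ _ x] t True by force
            then show ?thesis using t True by (intro exI[of _ z]) auto
          next
            case False
            then have tx: "X i < t" using X(1) by (metis DiffE insertI1 linorder_neqE_linordered_idom)
            obtain z where "X i < z" "z < t" "F t x - F (X i) x = (t - X i) * F' z x"
              using MVT2[OF tx, of "\<lambda>s. F s x" "\<lambda>s. F' s x"] D[OF _ _ x] t True by force
            then show ?thesis using t True by (intro exI[of _ z]) (auto simp: algebra_simps)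
          qed
          then obtain z where z: "a < z" "z < b" "F (X i) x - F t x = (X i - t) * F' z x"
            by blast
          then have "q (X i) x = F' z x" using X(1) True by (simp add: q_def)
          then show ?thesis using bound[OF z(1,2) x] by simp
        qed (use bound[OF t x] in \<open>auto simp: q_def\<close>)
      qed
      show "AE x in M. (\<lambda>i. q (X i) x) \<longlonglongrightarrow> F' t x"
      proof (rule AE_I2)
        fix x assume x: "x \<in> space M"
        have "((\<lambda>s. (F s x - F t x) / (s - t)) \<longlongrightarrow> F' t x) (at t)"
          using D[OF t x] by (simp add: has_field_derivative_iff)
        then have *: "(\<lambda>i. (F (X i) x - F t x) / (X i - t)) \<longlonglongrightarrow> F' t x"
          using X unfolding tendsto_at_iff_sequentially comp_def by blast
        have "\<forall>\<^sub>F i in sequentially. X i \<in> {a<..<b}"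
          using X(2) t by (intro topological_tendstoD) auto
        then show "(\<lambda>i. q (X i) x) \<longlonglongrightarrow> F' t x"
          by (intro Lim_transform_eventually[OF *]) (auto elim!: eventually_mono simp: q_def)
      qed
    qed
  qed
  moreover have "\<forall>\<^sub>F s in at t. (\<integral>x. q s x \<partial>M) = ((\<integral>x. F s x \<partial>M) - (\<integral>x. F t x \<partial>M)) / (s - t)"
  proof -
    have "\<forall>\<^sub>F s in at t. s \<in> {a<..<b}"
      using t by (intro eventually_at_in_open') auto
    then show ?thesis
      by (rule eventually_mono) (use int t in \<open>simp add: q_def\<close>)
  qed
  ultimately show ?thesis
    unfolding has_field_derivative_iff by (rule Lim_transform_eventually)
qed

lemma set_integrable_mult_bounded:
  fixes f g :: "real \<Rightarrow> real"
  assumes f: "set_integrable lborel A f" and A: "A \<in> sets borel"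
    and g [measurable]: "g \<in> borel_measurable borel" and bound: "\<And>x. x \<in> A \<Longrightarrow> \<bar>g x\<bar> \<le> C"
  shows "set_integrable lborel A (\<lambda>x. f x * g x)"
proof -
  have int: "integrable lborel (\<lambda>x. indicator A x *\<^sub>R f x)"
    using f by (simp add: set_integrable_def)
  then have "(\<lambda>x. indicator A x *\<^sub>R f x) \<in> borel_measurable lborel"
    by auto
  then have [measurable]: "(\<lambda>x. indicator A x * f x) \<in> borel_measurable borel"
    by simp
  have "integrable lborel (\<lambda>x. (indicator A x *\<^sub>R f x) * g x)"
  proof (rule Bochner_Integration.integrable_bound)
    show "integrable lborel (\<lambda>x. (indicator A x *\<^sub>R f x) * C)"
      using int by (rule integrable_mult_left)
    show "AE x in lborel. norm ((indicator A x *\<^sub>R f x) * g x) \<le> norm ((indicator A x *\<^sub>R f x) * C)"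
      using bound by (intro AE_I2) (force simp: indicator_def abs_mult intro!: mult_left_mono)
  qed simp
  then show ?thesis by (simp add: set_integrable_def mult.assoc)
qed

lemma abs_mult_std_normal_density_le: "\<bar>z\<bar> * std_normal_density z \<le> 1"
proof -
  have "0 \<le> (\<bar>z\<bar> - 1)\<^sup>2" by simp
  then have "\<bar>z\<bar> \<le> 1 + z\<^sup>2 / 2"
    by (simp add: power2_eq_square algebra_simps)
  also have "\<dots> \<le> exp (z\<^sup>2 / 2)" by (rule exp_ge_add_one_self)
  finally have "\<bar>z\<bar> * exp (- z\<^sup>2 / 2) \<le> 1"
    by (simp add: exp_minus field_simps)
  moreover have "1 / sqrt (2 * pi) \<le> 1"
    using pi_gt3 by simp
  ultimately have "(1 / sqrt (2 * pi)) * (\<bar>z\<bar> * exp (- z\<^sup>2 / 2)) \<le> 1 * 1"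
    by (intro mult_mono) auto
  then show ?thesis by (simp add: std_normal_density_def)
qed

lemma std_normal_density_le: "std_normal_density z \<le> 1"
proof -
  have "(1 / sqrt (2 * pi)) * exp (- z\<^sup>2 / 2) \<le> 1 * 1"
    using pi_gt3 by (intro mult_mono) auto
  then show ?thesis by (simp add: std_normal_density_def)
qed

text \<open>In the variable \<open>z\<close> one has
  \<open>y = sqrt s * (z + \<gamma> * sqrt s)\<close>, so \<open>y\<close> disappears and only
  \<open>z\<close> times the normal density, and the density itself, have to be bounded. Uniformity
  in \<open>y\<close> is what permits differentiation under the integral.\<close>

lemma first_passage_density_bound:
  assumes "0 < s" "0 \<le> \<gamma>"
  shows "\<bar>first_passage_density \<gamma> y s\<bar> \<le> (1 + \<gamma> * sqrt s) / s"
proof -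
  define r where "r = sqrt s"
  define z where "z = (y - \<gamma> * s) / r"
  have r: "r > 0" "s = r * r" using assms by (auto simp: r_def)
  have y: "y = r * (z + \<gamma> * r)"
    unfolding z_def r(2) using r(1) by (simp add: field_simps)
  have "first_passage_density \<gamma> y s = (y / r) * std_normal_density z / s"
    by (simp add: first_passage_density_def z_def r_def)
  also have "y / r = z + \<gamma> * r"
    using y r(1) by simp
  finally have "\<bar>first_passage_density \<gamma> y s\<bar> = \<bar>(z + \<gamma> * r) * std_normal_density z\<bar> / s"
    using assms(1) by (simp add: abs_mult)
  also have "\<bar>(z + \<gamma> * r) * std_normal_density z\<bar>
      \<le> \<bar>z\<bar> * std_normal_density z + \<gamma> * r * std_normal_density z"
    using r assms unfolding distrib_right by (intro order.trans[OF abs_triangle_ineq]) (simp add: abs_mult)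
  also have "\<dots> \<le> 1 + \<gamma> * r * 1"
    using r assms by (intro add_mono mult_left_mono abs_mult_std_normal_density_le std_normal_density_le) auto
  finally show ?thesis
    using assms(1) by (simp add: r_def divide_right_mono)
qed

lemma drifted_max_density_le:
  assumes "0 < t" "0 \<le> \<gamma>"
  shows "drifted_max_density \<gamma> y t \<le> 2 * (std_normal_density ((y - \<gamma> * t) / sqrt t) / sqrt t)"
  using assms std_normal_cdf_nonneg[of "- (y + \<gamma> * t) / sqrt t"]
  by (simp add: drifted_max_density_def del: minus_add_distrib)

lemma drifted_max_density_bounded:
  assumes "0 < t" "0 \<le> \<gamma>" "0 \<le> y"
  shows "\<bar>drifted_max_density \<gamma> y t\<bar> \<le> 2 / sqrt t"
proof -
  have "drifted_max_density \<gamma> y t \<le> 2 * (1 / sqrt t)"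
    using assms
    by (intro order.trans[OF drifted_max_density_le] mult_left_mono divide_right_mono std_normal_density_le) auto
  then show ?thesis using drifted_max_density_nonneg[OF assms] by simp
qed

lemma drifted_max_density_at_top:
  assumes "0 < t" "0 \<le> \<gamma>"
  shows "((\<lambda>y. drifted_max_density \<gamma> y t) \<longlongrightarrow> 0) at_top"
proof (rule tendsto_sandwich)
  show "\<forall>\<^sub>F y in at_top. 0 \<le> drifted_max_density \<gamma> y t"
    by (rule eventually_mono[OF eventually_ge_at_top[of 0]]) (rule drifted_max_density_nonneg[OF assms])
  show "\<forall>\<^sub>F y in at_top. drifted_max_density \<gamma> y t
      \<le> 2 * (std_normal_density ((y - \<gamma> * t) / sqrt t) / sqrt t)"
    using drifted_max_density_le[OF assms] by simp
  have "(std_normal_density \<longlongrightarrow> 0) at_top"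
    unfolding std_normal_density_def[abs_def] by real_asymp
  moreover have "filterlim (\<lambda>y. (y - \<gamma> * t) / sqrt t) at_top at_top"
  proof -
    define a r where "a = \<gamma> * t" and "r = sqrt t"
    have "r > 0" using assms by (simp add: r_def)
    then have "filterlim (\<lambda>y. (y - a) / r) at_top at_top" by real_asymp
    then show ?thesis by (simp add: a_def r_def)
  qed
  ultimately have "((\<lambda>y. std_normal_density ((y - \<gamma> * t) / sqrt t)) \<longlongrightarrow> 0) at_top"
    by (rule filterlim_compose)
  then show "((\<lambda>y. 2 * (std_normal_density ((y - \<gamma> * t) / sqrt t) / sqrt t)) \<longlongrightarrow> 0) at_top"
    by (intro tendsto_mult_right_zero tendsto_divide_zero)
qed simp

lemma drifted_max_tail_nonneg: "0 \<le> drifted_max_tail \<gamma> y t"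
  by (simp add: drifted_max_tail_def std_normal_cdf_nonneg)

lemma first_passage_density_cont:
  assumes "0 < t"
  shows "isCont (\<lambda>y. first_passage_density \<gamma> y t) y"
  unfolding first_passage_density_def using assms
  by (intro continuous_intros DERIV_isCont[OF DERIV_std_normal_affine(2)]) auto

text \<open>The outer factor \<open>\<delta>\<close> comes from dividing the maximum by
  \<open>\<delta>\<close>. The formula is smooth across \<open>x = 0\<close>, and its value there
  will serve as \<open>h(0, t)\<close>.\<close>

definition hitting_density :: "real \<Rightarrow> real \<Rightarrow> real \<Rightarrow> real \<Rightarrow> real" where
  "hitting_density \<delta> \<gamma> x t = \<delta> * drifted_max_density \<gamma> (\<delta> * x) t"

lemma hitting_density_bounded:
  assumes "0 < t" "0 \<le> \<gamma>" "0 < \<delta>" "0 \<le> x"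
  shows "\<bar>hitting_density \<delta> \<gamma> x t\<bar> \<le> \<delta> * (2 / sqrt t)"
  using assms unfolding hitting_density_def abs_mult
  by (intro mult_mono drifted_max_density_bounded) auto

lemma isCont_hitting_density:
  assumes "0 < t"
  shows "isCont (\<lambda>x. hitting_density \<delta> \<gamma> x t) x"
  unfolding hitting_density_def
  by (intro continuous_intros
      DERIV_isCont[OF DERIV_chain2[OF DERIV_drifted_max_density_space[OF assms] DERIV_cmult_Id[of \<delta>]]])

text \<open>Integration by parts, the tail being equal to 1 at the origin. Afterwards
  \<open>t\<close> occurs only in the tail, whose time derivative is explicit and bounded, while the
  boundary term \<open>\<phi> 0\<close> is constant in time.\<close>

lemma integral_hitting_density:
  fixes \<phi> \<phi>' :: "real \<Rightarrow> real"
  assumes t: "0 < t" and \<gamma>: "0 \<le> \<gamma>" and \<delta>: "0 < \<delta>"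
    and D: "\<And>x. (\<phi> has_real_derivative \<phi>' x) (at x)" and cont: "\<And>x. isCont \<phi>' x"
    and int: "set_integrable lborel {0<..} \<phi>" "set_integrable lborel {0<..} \<phi>'"
    and lim: "(\<phi> \<longlongrightarrow> 0) at_top"
  shows "(LINT x:{0<..}|lborel. \<phi> x * hitting_density \<delta> \<gamma> x t)
    = \<phi> 0 + (LINT x:{0<..}|lborel. \<phi>' x * drifted_max_tail \<gamma> (\<delta> * x) t)"
proof -
  let ?T = "\<lambda>x. drifted_max_tail \<gamma> (\<delta> * x) t" and ?q = "\<lambda>x. hitting_density \<delta> \<gamma> x t"
  have DT: "(?T has_real_derivative - ?q x) (at x)" for x
    by (rule DERIV_cong[OF DERIV_chain2[OF DERIV_drifted_max_tail_space[OF t] DERIV_cmult_Id]])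
      (simp add: hitting_density_def)
  have Cq: "isCont ?q x" for x by (rule isCont_hitting_density[OF t])
  have Tm [measurable]: "?T \<in> borel_measurable borel" "?q \<in> borel_measurable borel"
    by (auto intro!: borel_measurable_continuous_onI continuous_at_imp_continuous_on
        Cq DERIV_isCont[OF DT])
  have bT: "\<bar>?T x\<bar> \<le> 1" if "x \<in> {0<..}" for x
    using that drifted_max_tail_le_1[OF t \<gamma>, of "\<delta> * x"] \<delta> by (simp add: drifted_max_tail_nonneg)
  have bq: "\<bar>?q x\<bar> \<le> \<delta> * (2 / sqrt t)" if "x \<in> {0<..}" for x
    using that by (intro hitting_density_bounded t \<gamma> \<delta>) auto
  note i1 = set_integrable_mult_bounded[OF int(1) _ Tm(2) bq, simplified]
  note i2 = set_integrable_mult_bounded[OF int(2) _ Tm(1) bT, simplified]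
  have "(LINT x:{0<..}|lborel. \<phi> x * ?q x) - (LINT x:{0<..}|lborel. \<phi>' x * ?T x)
    = (LINT x:{0<..}|lborel. \<phi> x * ?q x - \<phi>' x * ?T x)"
    by (rule set_integral_diff(2)[symmetric, OF i1 i2])
  also have "\<dots> = 0 - (- \<phi> 0)"
  proof (rule FTC_greaterThan[where F = "\<lambda>x. - (\<phi> x * ?T x)"])
    show "((\<lambda>x. - (\<phi> x * ?T x)) has_real_derivative \<phi> x * ?q x - \<phi>' x * ?T x) (at x)" for x
      using DERIV_minus[OF DERIV_mult[OF D DT, of x]] by (simp add: algebra_simps)
    show "isCont (\<lambda>x. \<phi> x * ?q x - \<phi>' x * ?T x) x" for x
      by (intro continuous_intros Cq cont DERIV_isCont[OF D] DERIV_isCont[OF DT])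
    show "set_integrable lborel {0<..} (\<lambda>x. \<phi> x * ?q x - \<phi>' x * ?T x)"
      by (rule set_integral_diff(1)[OF i1 i2])
    have "isCont (\<lambda>x. - (\<phi> x * ?T x)) 0"
      by (intro continuous_intros DERIV_isCont[OF D] DERIV_isCont[OF DT])
    then show "((\<lambda>x. - (\<phi> x * ?T x)) \<longlongrightarrow> - \<phi> 0) (at_right 0)"
      by (simp add: isCont_def drifted_max_tail_0 filterlim_at_split)
    show "((\<lambda>x. - (\<phi> x * ?T x)) \<longlongrightarrow> 0) at_top"
    proof (rule tendsto_rabs_zero_cancel, rule tendsto_sandwich[of "\<lambda>_. 0" _ _ "\<lambda>x. \<bar>\<phi> x\<bar>"])
      show "\<forall>\<^sub>F x in at_top. \<bar>- (\<phi> x * ?T x)\<bar> \<le> \<bar>\<phi> x\<bar>"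
        using bT by (intro eventually_mono[OF eventually_gt_at_top[of 0]])
          (simp add: abs_mult mult_left_le)
      show "((\<lambda>x. \<bar>\<phi> x\<bar>) \<longlongrightarrow> 0) at_top"
        using lim by (rule tendsto_rabs_zero)
    qed auto
  qed
  finally show ?thesis by simp
qed

text \<open>
  The density solves \<open>q\<^sub>t = q\<^sub>x\<^sub>x / (2 \<delta>\<^sup>2) - (\<gamma> / \<delta>) q\<^sub>x\<close> with reflection at the origin; tested against \<open>\<phi>\<close>,
  this leaves the boundary term \<open>\<phi>' 0 q(0, t)\<close>.
\<close>

lemma DERIV_integral_hitting_density:
  fixes \<phi> \<phi>' \<phi>'' :: "real \<Rightarrow> real"
  assumes t: "0 < t" and \<gamma>: "0 \<le> \<gamma>" and \<delta>: "0 < \<delta>"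
    and D: "\<And>x. (\<phi> has_real_derivative \<phi>' x) (at x)"
    and D': "\<And>x. (\<phi>' has_real_derivative \<phi>'' x) (at x)" and cont: "\<And>x. isCont \<phi>'' x"
    and int: "set_integrable lborel {0<..} \<phi>" "set_integrable lborel {0<..} \<phi>'"
      "set_integrable lborel {0<..} \<phi>''"
    and lim: "(\<phi> \<longlongrightarrow> 0) at_top" "(\<phi>' \<longlongrightarrow> 0) at_top"
  shows "((\<lambda>t. LINT x:{0<..}|lborel. \<phi> x * hitting_density \<delta> \<gamma> x t) has_real_derivative
    1 / (2 * \<delta>\<^sup>2) * ((LINT x:{0<..}|lborel. \<phi>'' x * hitting_density \<delta> \<gamma> x t)
      + 2 * \<delta> * \<gamma> * (LINT x:{0<..}|lborel. \<phi>' x * hitting_density \<delta> \<gamma> x t)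
      + \<phi>' 0 * hitting_density \<delta> \<gamma> 0 t)) (at t)"
proof -
  let ?T = "\<lambda>s x. drifted_max_tail \<gamma> (\<delta> * x) s" and ?q = "\<lambda>x. hitting_density \<delta> \<gamma> x t"
    and ?p = "\<lambda>s x. first_passage_density \<gamma> (\<delta> * x) s"
  have C': "isCont \<phi>' x" for x using D' by (rule DERIV_isCont)
  have CT: "isCont (?T s) x" if "0 < s" for s x
    by (intro DERIV_isCont[OF DERIV_chain2[OF DERIV_drifted_max_tail_space[OF that] DERIV_cmult_Id[of \<delta>]]])
  have Tm [measurable]: "?T s \<in> borel_measurable borel" if "0 < s" for s
    using that by (auto intro!: borel_measurable_continuous_onI continuous_at_imp_continuous_on CT)
  have Cp: "isCont (?p t) x" for x
    using isCont_o2[OF _ first_passage_density_cont[OF t], of x "\<lambda>x. \<delta> * x" \<gamma>]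
    by (simp add: isCont_def tendsto_mult_left)
  have pm [measurable]: "?p t \<in> borel_measurable borel"
    by (auto intro!: borel_measurable_continuous_onI continuous_at_imp_continuous_on Cp)
  \<comment> \<open>In the last term, one factor \<open>\<delta>\<close> comes from the definition
    of the density and one from the chain rule.\<close>
  have Dq: "(?q has_real_derivative 2 * \<gamma> * \<delta> * ?q x - 2 * \<delta>\<^sup>2 * ?p t x) (at x)" for x
    unfolding hitting_density_def
    by (rule DERIV_cong[OF DERIV_cmult[OF DERIV_chain2[OF DERIV_drifted_max_density_space[OF t] DERIV_cmult_Id]]])
      (simp add: algebra_simps power2_eq_square)
  have Cq: "isCont ?q x" for x using Dq by (rule DERIV_isCont)
  have qm [measurable]: "?q \<in> borel_measurable borel"
    by (auto intro!: borel_measurable_continuous_onI continuous_at_imp_continuous_on Cq)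
  have bT: "\<bar>?T s x\<bar> \<le> 1" if "0 < s" "x \<in> {0<..}" for s x
    using that drifted_max_tail_le_1[OF that(1) \<gamma>, of "\<delta> * x"] \<delta> by (simp add: drifted_max_tail_nonneg)
  have bq: "\<bar>?q x\<bar> \<le> \<delta> * (2 / sqrt t)" if "x \<in> {0<..}" for x
    using that by (intro hitting_density_bounded t \<gamma> \<delta>) auto
  note iT = set_integrable_mult_bounded[OF int(2) _ Tm bT, simplified]
  note ip = set_integrable_mult_bounded[OF int(2) _ pm first_passage_density_bound[OF t \<gamma>], simplified]
  note iq' = set_integrable_mult_bounded[OF int(2) _ qm bq, simplified]
  note iq'' = set_integrable_mult_bounded[OF int(3) _ qm bq, simplified]

  \<comment> \<open>This makes \<open>first_passage_density_bound\<close> uniform over times between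
    \<open>t / 2\<close> and \<open>2 * t\<close>: the numerator is largest at \<open>2 * t\<close>,
    the denominator smallest at \<open>t / 2\<close>.\<close>
  define C where "C = (1 + \<gamma> * sqrt (2 * t)) / (t / 2)"
  have pC: "\<bar>?p s x\<bar> \<le> C" if "t / 2 < s" "s < 2 * t" for s x
  proof -
    have "\<bar>?p s x\<bar> \<le> (1 + \<gamma> * sqrt s) / s"
      using that t by (intro first_passage_density_bound \<gamma>) auto
    also have "\<dots> \<le> C"
      unfolding C_def using that t \<gamma> by (intro frac_le add_mono mult_left_mono) auto
    finally show ?thesis .
  qed
  have "((\<lambda>s. \<integral>x. indicator {0<..} x *\<^sub>R (\<phi>' x * ?T s x) \<partial>lborel) has_real_derivative
      (\<integral>x. indicator {0<..} x *\<^sub>R (\<phi>' x * ?p t x) \<partial>lborel)) (at t)"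
  proof (rule has_real_derivative_integral_dominated
      [where a = "t / 2" and b = "2 * t" and w = "\<lambda>x. \<bar>indicator {0<..} x *\<^sub>R \<phi>' x\<bar> * C"
         and F' = "\<lambda>s x. indicator {0<..} x *\<^sub>R (\<phi>' x * ?p s x)"])
    fix s assume s: "t / 2 < s" "s < 2 * t"
    then have "0 < s" using t by simp
    then show "integrable lborel (\<lambda>x. indicator {0<..} x *\<^sub>R (\<phi>' x * ?T s x))"
      using iT unfolding set_integrable_def by simp
    fix x
    show "((\<lambda>s. indicator {0<..} x *\<^sub>R (\<phi>' x * ?T s x)) has_real_derivative
        indicator {0<..} x *\<^sub>R (\<phi>' x * ?p s x)) (at s)"
      unfolding real_scaleR_def by (intro DERIV_cmult DERIV_drifted_max_tail_time \<open>0 < s\<close>)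
    show "\<bar>indicator {0<..} x *\<^sub>R (\<phi>' x * ?p s x)\<bar> \<le> \<bar>indicator {0<..} x *\<^sub>R \<phi>' x\<bar> * C"
      using pC[OF s, of x] by (auto simp: indicator_def abs_mult intro!: mult_left_mono)
  next
    show "integrable lborel (\<lambda>x. \<bar>indicator {0<..} x *\<^sub>R \<phi>' x\<bar> * C)"
      using int(2) unfolding set_integrable_def by (intro integrable_mult_left integrable_abs)
    show "(\<lambda>x. indicator {0<..} x *\<^sub>R (\<phi>' x * ?p t x)) \<in> borel_measurable lborel"
      using ip unfolding set_integrable_def by auto
  qed (use t in auto)
  then have "((\<lambda>s. \<phi> 0 + (LINT x:{0<..}|lborel. \<phi>' x * ?T s x)) has_real_derivative
      (LINT x:{0<..}|lborel. \<phi>' x * ?p t x)) (at t)"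
    unfolding set_lebesgue_integral_def by (auto intro!: derivative_eq_intros)
  then have "((\<lambda>s. LINT x:{0<..}|lborel. \<phi> x * hitting_density \<delta> \<gamma> x s) has_real_derivative
      (LINT x:{0<..}|lborel. \<phi>' x * ?p t x)) (at t)"
    by (rule has_field_derivative_transform_within_open[where S = "{0<..}"])
       (use t in \<open>simp_all add: integral_hitting_density[OF _ \<gamma> \<delta> D C' int(1,2) lim(1)]\<close>)
  \<comment> \<open>Second integration by parts: \<open>Dq\<close> expresses
    \<open>2 * \<delta>\<^sup>2 * ?p t x\<close> through \<open>?q\<close> and its derivative, and
    the derivative is moved onto \<open>\<phi>'\<close>. The origin leaves the term
    \<open>\<phi>' 0 * ?q 0\<close>, infinity leaves nothing.\<close>
  moreover have "2 * \<delta>\<^sup>2 * (LINT x:{0<..}|lborel. \<phi>' x * ?p t x)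
    = (LINT x:{0<..}|lborel. \<phi>'' x * ?q x) + 2 * \<delta> * \<gamma> * (LINT x:{0<..}|lborel. \<phi>' x * ?q x)
      + \<phi>' 0 * ?q 0"
  proof -
    let ?a = "\<lambda>x. \<phi>'' x * ?q x" and ?b = "\<lambda>x. 2 * \<delta> * \<gamma> * (\<phi>' x * ?q x)"
      and ?c = "\<lambda>x. 2 * \<delta>\<^sup>2 * (\<phi>' x * ?p t x)"
    have ib: "set_integrable lborel {0<..} ?b" and ic: "set_integrable lborel {0<..} ?c"
      using iq' ip by (auto intro: set_integrable_mult_right)
    have iab: "set_integrable lborel {0<..} (\<lambda>x. ?a x + ?b x)"
      by (rule set_integral_add(1)[OF iq'' ib])
    have "(LINT x:{0<..}|lborel. ?a x + ?b x - ?c x) = 0 - \<phi>' 0 * ?q 0"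
    proof (rule FTC_greaterThan[where F = "\<lambda>x. \<phi>' x * ?q x"])
      show "((\<lambda>x. \<phi>' x * ?q x) has_real_derivative ?a x + ?b x - ?c x) (at x)" for x
        using DERIV_mult[OF D' Dq, of x] by (simp add: algebra_simps)
      show "isCont (\<lambda>x. ?a x + ?b x - ?c x) x" for x
        by (intro continuous_intros Cq cont C' Cp)
      show "set_integrable lborel {0<..} (\<lambda>x. ?a x + ?b x - ?c x)"
        by (rule set_integral_diff(1)[OF iab ic])
      have "isCont (\<lambda>x. \<phi>' x * ?q x) 0" by (intro continuous_intros C' Cq)
      then show "((\<lambda>x. \<phi>' x * ?q x) \<longlongrightarrow> \<phi>' 0 * ?q 0) (at_right 0)"
        by (simp add: isCont_def filterlim_at_split)
      have "filterlim (\<lambda>x. \<delta> * x) at_top at_top" using \<delta> by real_asymp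
      from filterlim_compose[OF drifted_max_density_at_top[OF t \<gamma>] this]
      have "(?q \<longlongrightarrow> 0) at_top"
        unfolding hitting_density_def by (rule tendsto_mult_right_zero)
      then show "((\<lambda>x. \<phi>' x * ?q x) \<longlongrightarrow> 0) at_top"
        using lim(2) by (auto intro!: tendsto_eq_intros)
    qed
    also have "(LINT x:{0<..}|lborel. ?a x + ?b x - ?c x)
        = (LINT x:{0<..}|lborel. ?a x) + (LINT x:{0<..}|lborel. ?b x) - (LINT x:{0<..}|lborel. ?c x)"
      using set_integral_diff(2)[OF iab ic] set_integral_add(2)[OF iq'' ib] by simp
    finally show ?thesis by simp
  qed
  then have "(LINT x:{0<..}|lborel. \<phi>' x * ?p t x) = 1 / (2 * \<delta>\<^sup>2) *
      ((LINT x:{0<..}|lborel. \<phi>'' x * ?q x) + 2 * \<delta> * \<gamma> * (LINT x:{0<..}|lborel. \<phi>' x * ?q x)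
      + \<phi>' 0 * ?q 0)"
    using \<delta> by (simp add: field_simps)
  ultimately show ?thesis by simp
qed

subsection \<open>The law of the hitting time\<close>

definition reflection_weight :: "real \<Rightarrow> real \<Rightarrow> real" where
  "reflection_weight \<gamma> y = (if y \<le> 0 then 1 + exp (2 * \<gamma> * y) else 0)"

lemma reflection_weight_measurable [measurable]: "reflection_weight \<gamma> \<in> borel_measurable borel"
  unfolding reflection_weight_def[abs_def] by measurable

lemma reflection_weight_bounds:
  assumes "0 \<le> \<gamma>"
  shows "0 \<le> reflection_weight \<gamma> y" "reflection_weight \<gamma> y \<le> 2"
    "y \<le> 0 \<Longrightarrow> 1 \<le> reflection_weight \<gamma> y"
  using assms by (auto simp: reflection_weight_def mult_nonneg_nonpos add_nonneg_nonneg)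

text \<open>The exponential turns the normal law of mean \<open>\<gamma> * t\<close> into
  \<open>exp (2 * \<gamma> * c)\<close> times the one of mean \<open>- (\<gamma> * t)\<close>, so
  both halves of the weight become upper tails beyond \<open>c\<close>.\<close>

lemma integral_reflection_weight:
  assumes t: "0 < t"
  shows "(\<integral>v. normal_density (\<gamma> * t) (sqrt t) v * reflection_weight \<gamma> (c - v) \<partial>lborel)
    = drifted_max_tail \<gamma> c t" (is "?lhs = _")
proof -
  have tilt: "normal_density (\<gamma> * t) (sqrt t) v * exp (2 * \<gamma> * (c - v))
      = exp (2 * \<gamma> * c) * normal_density (- (\<gamma> * t)) (sqrt t) v" for v
  proof -
    have "- (v - \<gamma> * t)\<^sup>2 / (2 * t) + 2 * \<gamma> * (c - v) = 2 * \<gamma> * c + - (v + \<gamma> * t)\<^sup>2 / (2 * t)"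
      using t by (simp add: field_simps power2_eq_square)
    then have "exp (- (v - \<gamma> * t)\<^sup>2 / (2 * t)) * exp (2 * \<gamma> * (c - v))
        = exp (2 * \<gamma> * c) * exp (- (v + \<gamma> * t)\<^sup>2 / (2 * t))"
      by (simp only: exp_add[symmetric])
    then show ?thesis using t by (simp add: normal_density_def)
  qed
  have "(\<integral>v. normal_density (\<gamma> * t) (sqrt t) v * reflection_weight \<gamma> (c - v) \<partial>lborel)
    = (LINT v:{c..}|lborel. normal_density (\<gamma> * t) (sqrt t) v
        + exp (2 * \<gamma> * c) * normal_density (- (\<gamma> * t)) (sqrt t) v)"
    unfolding set_lebesgue_integral_def
    by (intro Bochner_Integration.integral_cong refl)
      (auto simp: reflection_weight_def indicator_def distrib_left tilt)
  also have "\<dots> = std_normal_cdf ((\<gamma> * t - c) / sqrt t)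
      + exp (2 * \<gamma> * c) * std_normal_cdf ((- (\<gamma> * t) - c) / sqrt t)"
    using t by (subst set_integral_add) (auto simp: normal_upper_tail)
  finally have "?lhs = \<dots>" .
  moreover have "- (\<gamma> * t) - c = - (c + \<gamma> * t)" by simp
  ultimately show ?thesis by (simp only: drifted_max_tail_def)
qed

lemma drifted_max_tail_le_2:
  assumes "0 \<le> \<gamma>" "y \<le> 0"
  shows "drifted_max_tail \<gamma> y t \<le> 2"
proof -
  have "exp (2 * \<gamma> * y) * std_normal_cdf (- (y + \<gamma> * t) / sqrt t) \<le> 1 * 1"
    using assms by (intro mult_mono std_normal_cdf_le_1 std_normal_cdf_nonneg) (auto simp: mult_nonneg_nonpos)
  then show ?thesis
    using std_normal_cdf_le_1[of "(\<gamma> * t - y) / sqrt t"] by (simp add: drifted_max_tail_def)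
qed

lemma drifted_max_tail_measurable [measurable]:
  assumes "0 < t"
  shows "(\<lambda>y. drifted_max_tail \<gamma> y t) \<in> borel_measurable borel"
  by (intro borel_measurable_continuous_onI continuous_at_imp_continuous_on ballI
      DERIV_isCont[OF DERIV_drifted_max_tail_space[OF assms]])

section \<open>The reflection argument on finite grids\<close>

context prob_space
begin

lemma integrable_bounded:
  fixes f :: "'a \<Rightarrow> real"
  assumes "f \<in> borel_measurable M" "\<And>\<omega>. \<omega> \<in> space M \<Longrightarrow> \<bar>f \<omega>\<bar> \<le> C"
  shows "integrable M f"
  using assms by (intro integrable_const_bound[of _ C]) auto

text \<open>The joint law is the product of the marginals, so by Fubini \<open>U\<close> can be
  frozen while \<open>V\<close> is averaged separately. This stands in for conditional
  expectations.\<close>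

lemma expectation_indep_pair:
  fixes F :: "'b \<times> 'b \<Rightarrow> real"
  assumes ind: "indep_var S U T V"
    and F [measurable]: "F \<in> borel_measurable (S \<Otimes>\<^sub>M T)" and bound: "\<And>z. \<bar>F z\<bar> \<le> C"
  shows "expectation (\<lambda>\<omega>. F (U \<omega>, V \<omega>)) = expectation (\<lambda>\<omega>. expectation (\<lambda>\<omega>'. F (U \<omega>, V \<omega>')))"
proof -
  have U [measurable]: "U \<in> measurable M S" and V [measurable]: "V \<in> measurable M T"
    using ind by (auto dest: indep_var_rv1 indep_var_rv2)
  have eq: "distr M S U \<Otimes>\<^sub>M distr M T V = distr M (S \<Otimes>\<^sub>M T) (\<lambda>\<omega>. (U \<omega>, V \<omega>))"
    using ind by (simp add: indep_var_distribution_eq)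
  interpret U: prob_space "distr M S U" by (rule prob_space_distr) simp
  interpret V: prob_space "distr M T V" by (rule prob_space_distr) simp
  interpret UV: pair_prob_space "distr M S U" "distr M T V" ..
  have int: "integrable (distr M S U \<Otimes>\<^sub>M distr M T V) F"
    by (rule UV.integrable_const_bound[of _ C]) (use bound in auto)
  have "expectation (\<lambda>\<omega>. F (U \<omega>, V \<omega>)) = integral\<^sup>L (distr M (S \<Otimes>\<^sub>M T) (\<lambda>\<omega>. (U \<omega>, V \<omega>))) F"
    by (rule integral_distr[symmetric]) auto
  also have "\<dots> = (\<integral>u. (\<integral>v. F (u, v) \<partial>distr M T V) \<partial>distr M S U)"
    unfolding eq[symmetric] by (rule UV.integral_fst'[OF int, symmetric])
  also have "\<dots> = (\<integral>\<omega>. (\<integral>v. F (U \<omega>, v) \<partial>distr M T V) \<partial>M)"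
    by (rule integral_distr) (auto intro!: V.borel_measurable_lebesgue_integral)
  also have "\<dots> = expectation (\<lambda>\<omega>. expectation (\<lambda>\<omega>'. F (U \<omega>, V \<omega>')))"
  proof (intro Bochner_Integration.integral_cong refl)
    fix \<omega> assume "\<omega> \<in> space M"
    then have "U \<omega> \<in> space S" using U by (rule measurable_space[rotated])
    then have [measurable]: "(\<lambda>v. F (U \<omega>, v)) \<in> borel_measurable T" by measurable
    show "(\<integral>v. F (U \<omega>, v) \<partial>distr M T V) = expectation (\<lambda>\<omega>'. F (U \<omega>, V \<omega>'))"
      by (rule integral_distr) auto
  qed
  finally show ?thesis .
qed

lemma prob_eventually_not_in:
  assumes A [measurable]: "\<And>n. A n \<in> events" and ev: "AE \<omega> in M. \<forall>\<^sub>F n in sequentially. \<omega> \<notin> A n"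
  shows "(\<lambda>n. prob (A n)) \<longlonglongrightarrow> 0"
proof -
  have "(\<lambda>n. \<integral>\<omega>. indicat_real (A n) \<omega> \<partial>M) \<longlonglongrightarrow> (\<integral>\<omega>. 0 \<partial>M)"
  proof (rule integral_dominated_convergence[where w = "\<lambda>_. 1"])
    show "AE \<omega> in M. (\<lambda>n. indicat_real (A n) \<omega>) \<longlonglongrightarrow> 0"
      using ev
    proof eventually_elim
      case (elim \<omega>)
      then show ?case
        by (intro tendsto_eventually) (auto elim!: eventually_mono)
    qed
  qed auto
  then show ?thesis by simp
qed

lemma brownian_increment_distributed:
  assumes "standard_brownian_motion B" "0 \<le> s" "s < t"
  shows "distributed M lborel (\<lambda>\<omega>. B t \<omega> - B s \<omega> + \<gamma> * (t - s))
    (normal_density (\<gamma> * (t - s)) (sqrt (t - s)))"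
proof -
  have "distributed M lborel (\<lambda>\<omega>. B t \<omega> - B s \<omega>) (normal_density 0 (sqrt (t - s)))"
    using assms unfolding standard_brownian_motion_def by blast
  from normal_density_affine[OF this, of 1 "\<gamma> * (t - s)"] show ?thesis
    using assms by (simp add: add.commute)
qed

text \<open>
  The drifted Brownian motion is written as \<open>B s \<omega> - B 0 \<omega> + \<gamma> * s\<close>, since \<open>B 0\<close> vanishes only
  almost surely.
\<close>

lemma expectation_first_passage:
  fixes \<tau> :: "nat \<Rightarrow> real" and m :: real
  assumes B: "standard_brownian_motion B" and \<gamma>: "0 \<le> \<gamma>"
    and \<tau>: "\<tau> 0 = 0" "mono_on {..j} \<tau>" "\<tau> j < t"
  defines "X \<equiv> \<lambda>s \<omega>. B s \<omega> - B 0 \<omega> + \<gamma> * s"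
  defines "A \<equiv> {\<omega> \<in> space M. m \<le> X (\<tau> j) \<omega> \<and> (\<forall>i<j. X (\<tau> i) \<omega> < m)}"
  shows "expectation (\<lambda>\<omega>. indicator A \<omega> * reflection_weight \<gamma> (c - X t \<omega>))
    = expectation (\<lambda>\<omega>. indicator A \<omega> * drifted_max_tail \<gamma> (c - X (\<tau> j) \<omega>) (t - \<tau> j))"
proof -
  \<comment> \<open>The grid is cut off after \<open>\<tau> j\<close> and \<open>t\<close> is
    appended, so that the increments before \<open>\<tau> j\<close> and the one from
    \<open>\<tau> j\<close> to \<open>t\<close> belong to a single independent family.\<close>
  define ts where "ts i = (if i \<le> j then \<tau> i else t)" for i
  define \<xi> where "\<xi> i \<omega> = B (ts (Suc i)) \<omega> - B (ts i) \<omega>" for i \<omega>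
  define x where "x i u = \<gamma> * \<tau> i + (\<Sum>l<i. u l)" for i and u :: "nat \<Rightarrow> real"
  define U where "U \<omega> = (\<lambda>i\<in>{..<j}. \<xi> i \<omega>)" for \<omega>
  define V where "V \<omega> = (\<lambda>i\<in>{j}. \<xi> i \<omega>)" for \<omega>
  define P where "P = (\<Pi>\<^sub>M i\<in>{..<j}. (borel :: real measure))"
  define Q where "Q = (\<Pi>\<^sub>M i\<in>{j}. (borel :: real measure))"
  \<comment> \<open>The event \<open>A\<close> is decided by the first \<open>j\<close> increments,
    collected in the first component; the last increment enters the weight only.\<close>
  define F where "F z = (if m \<le> x j (fst z) \<and> (\<forall>i<j. x i (fst z) < m)
     then reflection_weight \<gamma> (c - x j (fst z) - (snd z j + \<gamma> * (t - \<tau> j))) else 0)" for z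
  have \<tau>j: "0 \<le> \<tau> j" using mono_onD[OF \<tau>(2), of 0 j] \<tau>(1) by simp
  have "mono_on {..Suc j} ts"
    using \<tau>(2,3) unfolding mono_on_def ts_def
    by (auto dest!: le_imp_less_or_eq) (metis le_refl less_imp_le less_le_trans not_less_eq_eq order.trans)
  moreover have "0 \<le> ts 0" using \<tau>(1) by (simp add: ts_def)
  ultimately have ind: "indep_vars (\<lambda>_. borel) \<xi> {..<Suc j}"
    using B unfolding standard_brownian_motion_def indep_increments_def \<xi>_def[abs_def] by blast
  have UV: "indep_var P U Q V"
    unfolding P_def Q_def U_def V_def by (rule indep_var_restrict[OF ind]) auto
  have xm [measurable]: "x i \<in> borel_measurable P" if "i \<le> j" for i
    unfolding x_def P_def using that
    by (intro borel_measurable_add borel_measurable_const borel_measurable_sum measurable_component_singleton) auto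
  have Fm: "F \<in> borel_measurable (P \<Otimes>\<^sub>M Q)"
  proof -
    have [measurable]: "(\<lambda>z. x i (fst z)) \<in> borel_measurable (P \<Otimes>\<^sub>M Q)" if "i \<le> j" for i
      using measurable_compose[OF measurable_fst xm[OF that]] .
    have [measurable]: "Measurable.pred (P \<Otimes>\<^sub>M Q) (\<lambda>z. \<forall>i<j. x i (fst z) < m)"
    proof -
      have "Measurable.pred (P \<Otimes>\<^sub>M Q) (\<lambda>z. \<forall>i\<in>{..<j}. x i (fst z) < m)"
        by (intro pred_intros_finite) auto
      then show ?thesis by (simp add: Ball_def)
    qed
    have [measurable]: "(\<lambda>z. snd z j) \<in> borel_measurable (P \<Otimes>\<^sub>M Q)"
      unfolding Q_def by (rule measurable_compose[OF measurable_snd measurable_component_singleton]) simp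
    show ?thesis unfolding F_def[abs_def] by measurable
  qed
  have xU: "x i (U \<omega>) = X (\<tau> i) \<omega>" if "i \<le> j" for i \<omega>
  proof -
    have "(\<Sum>l<i. U \<omega> l) = (\<Sum>l<i. B (\<tau> (Suc l)) \<omega> - B (\<tau> l) \<omega>)"
      using that by (intro sum.cong) (auto simp: U_def \<xi>_def ts_def)
    also have "\<dots> = B (\<tau> i) \<omega> - B 0 \<omega>"
      by (subst sum_lessThan_telescope) (simp add: \<tau>(1))
    finally show ?thesis by (simp add: x_def X_def)
  qed
  have V_eq: "V \<omega> j + \<gamma> * (t - \<tau> j) = B t \<omega> - B (\<tau> j) \<omega> + \<gamma> * (t - \<tau> j)" for \<omega>
    by (simp add: V_def \<xi>_def ts_def)
  have F_eq: "F (U \<omega>, V \<omega>') = indicator A \<omega> * reflection_weight \<gamma>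
      (c - X (\<tau> j) \<omega> - (B t \<omega>' - B (\<tau> j) \<omega>' + \<gamma> * (t - \<tau> j)))" if "\<omega> \<in> space M" for \<omega> \<omega>'
    using that by (auto simp: F_def A_def xU V_eq indicator_def)
  have "expectation (\<lambda>\<omega>. indicator A \<omega> * reflection_weight \<gamma> (c - X t \<omega>))
      = expectation (\<lambda>\<omega>. F (U \<omega>, V \<omega>))"
  proof (intro Bochner_Integration.integral_cong refl)
    fix \<omega> assume "\<omega> \<in> space M"
    moreover have "c - X (\<tau> j) \<omega> - (B t \<omega> - B (\<tau> j) \<omega> + \<gamma> * (t - \<tau> j)) = c - X t \<omega>"
      by (simp add: X_def algebra_simps)
    ultimately show "indicator A \<omega> * reflection_weight \<gamma> (c - X t \<omega>) = F (U \<omega>, V \<omega>)"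
      by (simp only: F_eq)
  qed
  also have "\<dots> = expectation (\<lambda>\<omega>. expectation (\<lambda>\<omega>'. F (U \<omega>, V \<omega>')))"
    using reflection_weight_bounds(1,2)[OF \<gamma>]
    by (intro expectation_indep_pair[OF UV Fm, of 2]) (simp add: F_def)
  also have "\<dots> = expectation (\<lambda>\<omega>. indicator A \<omega> * drifted_max_tail \<gamma> (c - X (\<tau> j) \<omega>) (t - \<tau> j))"
  proof (intro Bochner_Integration.integral_cong refl)
    fix \<omega> assume \<omega>: "\<omega> \<in> space M"
    have "expectation (\<lambda>\<omega>'. reflection_weight \<gamma>
        (c - X (\<tau> j) \<omega> - (B t \<omega>' - B (\<tau> j) \<omega>' + \<gamma> * (t - \<tau> j))))
      = (\<integral>v. normal_density (\<gamma> * (t - \<tau> j)) (sqrt (t - \<tau> j)) v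
          * reflection_weight \<gamma> (c - X (\<tau> j) \<omega> - v) \<partial>lborel)"
      by (rule distributed_integral[OF brownian_increment_distributed[OF B \<tau>j \<tau>(3)], symmetric]) auto
    also have "\<dots> = drifted_max_tail \<gamma> (c - X (\<tau> j) \<omega>) (t - \<tau> j)"
      using \<tau>(3) by (intro integral_reflection_weight) simp
    finally show "expectation (\<lambda>\<omega>'. F (U \<omega>, V \<omega>'))
        = indicator A \<omega> * drifted_max_tail \<gamma> (c - X (\<tau> j) \<omega>) (t - \<tau> j)"
      by (simp add: F_eq[OF \<omega>])
  qed
  finally show ?thesis .
qed

text \<open>
  At the first grid time with \<open>X \<ge> m\<close>, the conditional expectation of \<open>w(c - X(t))\<close> is at least \<open>1\<close> for
  \<open>c = m\<close>, and at most \<open>1\<close> for \<open>c = m + \<epsilon>\<close> unless the overshoot reaches \<open>\<epsilon>\<close>.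
\<close>

lemma first_passage_grid_bounds:
  fixes \<tau> :: "nat \<Rightarrow> real"
  assumes B: "standard_brownian_motion B" and \<gamma>: "0 \<le> \<gamma>" and m: "0 < m" and \<epsilon>: "0 < \<epsilon>"
    and \<tau>: "\<tau> 0 = 0" "strict_mono \<tau>" "\<tau> n = t" and n: "0 < n"
  defines "X \<equiv> \<lambda>s \<omega>. B s \<omega> - B 0 \<omega> + \<gamma> * s"
  shows "prob {\<omega> \<in> space M. \<exists>j\<le>n. m \<le> X (\<tau> j) \<omega>} \<le> drifted_max_tail \<gamma> m t"
    and "drifted_max_tail \<gamma> (m + \<epsilon>) t \<le> prob {\<omega> \<in> space M. \<exists>j\<le>n. m \<le> X (\<tau> j) \<omega>}
      + prob {\<omega> \<in> space M. \<exists>j<n. \<epsilon> \<le> X (\<tau> (Suc j)) \<omega> - X (\<tau> j) \<omega>}"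
proof -
  have \<tau>_nonneg: "0 \<le> \<tau> j" for j
    using strict_mono_less_eq[OF \<tau>(2), of 0 j] \<tau>(1) by simp
  have \<tau>_less: "\<tau> j < t" if "j < n" for j
    using strict_monoD[OF \<tau>(2) that] \<tau>(3) by simp
  have t: "0 < t" using \<tau>_less[OF n] \<tau>(1) by simp
  have [measurable]: "B s \<in> borel_measurable M" if "0 \<le> s" for s
    using B that by (simp add: standard_brownian_motion_def)
  have Xm [measurable]: "X s \<in> borel_measurable M" if "0 \<le> s" for s
    unfolding X_def using that by measurable
  have X\<tau> [measurable]: "X (\<tau> j) \<in> borel_measurable M" for j
    using \<tau>_nonneg by (rule Xm)
  have Xt [measurable]: "X t \<in> borel_measurable M" using t by (intro Xm) simp
  have X0: "X (\<tau> 0) \<omega> = 0" for \<omega> by (simp add: X_def \<tau>(1))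
  \<comment> \<open>Splitting \<open>D\<close> according to the index of the first grid time at or
    above the level replaces a stopping time by finitely many deterministic times, on disjoint
    events.\<close>
  define A where "A j = {\<omega> \<in> space M. m \<le> X (\<tau> j) \<omega> \<and> (\<forall>i<j. X (\<tau> i) \<omega> < m)}" for j
  define D where "D = {\<omega> \<in> space M. \<exists>j\<le>n. m \<le> X (\<tau> j) \<omega>}"
  define E where "E = {\<omega> \<in> space M. \<exists>j<n. \<epsilon> \<le> X (\<tau> (Suc j)) \<omega> - X (\<tau> j) \<omega>}"
  have Am [measurable]: "A j \<in> events" for j unfolding A_def by measurable
  have Dm [measurable]: "D \<in> events" unfolding D_def by measurable
  have Em [measurable]: "E \<in> events" unfolding E_def by measurable
  have A_unique: "i = j" if "\<omega> \<in> A i" "\<omega> \<in> A j" for i j \<omega>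
    using that unfolding A_def by (metis (lifting) linorder_neqE_nat mem_Collect_eq not_le)
  have D_A: "\<exists>j\<le>n. \<omega> \<in> A j" if D: "\<omega> \<in> D" for \<omega>
  proof -
    define j where "j = (LEAST j. m \<le> X (\<tau> j) \<omega>)"
    obtain i where i: "i \<le> n" "m \<le> X (\<tau> i) \<omega>" using D by (auto simp: D_def)
    have m: "m \<le> X (\<tau> j) \<omega>" unfolding j_def using i(2) by (rule LeastI)
    have ji: "j \<le> i" unfolding j_def using i(2) by (rule Least_le)
    have "X (\<tau> l) \<omega> < m" if "l < j" for l
      using not_less_Least[of l "\<lambda>j. m \<le> X (\<tau> j) \<omega>"] that by (simp add: j_def)
    with m D have "\<omega> \<in> A j" unfolding A_def D_def by blast
    moreover have "j \<le> n" using ji i(1) by simp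
    ultimately show ?thesis by blast
  qed
  have sum_A: "(\<Sum>j\<le>n. indicator (A j) \<omega> * f j) = f i"
    if "i \<le> n" "\<omega> \<in> A i" for i \<omega> and f :: "nat \<Rightarrow> real"
  proof -
    have "(\<Sum>j\<le>n. indicator (A j) \<omega> * f j) = (\<Sum>j\<le>n. if j = i then f i else 0)"
    proof (intro sum.cong refl)
      fix j
      show "indicator (A j) \<omega> * f j = (if j = i then f i else 0)"
        using A_unique[OF that(2), of j] that(2) by (cases "\<omega> \<in> A j") auto
    qed
    then show ?thesis using that(1) by simp
  qed
  have sum_A_0: "(\<Sum>j\<le>n. indicator (A j) \<omega> * f j) = 0" if "\<omega> \<notin> D" for \<omega> and f :: "nat \<Rightarrow> real"
    using that by (intro sum.neutral) (auto simp: A_def D_def indicator_def)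
  have ind_D: "indicator D \<omega> = (\<Sum>j\<le>n. indicat_real (A j) \<omega> * 1)" for \<omega>
    using sum_A[of _ \<omega> "\<lambda>_. 1"] sum_A_0[of \<omega> "\<lambda>_. 1"] D_A[of \<omega>] by (cases "\<omega> \<in> D") auto
  let ?R = "\<lambda>c \<omega>. reflection_weight \<gamma> (c - X t \<omega>)"
  note R = reflection_weight_bounds[OF \<gamma>]
  have int: "integrable M (\<lambda>\<omega>. indicat_real (A j) \<omega> * f \<omega>)"
    if "f \<in> borel_measurable M" "\<And>\<omega>. \<omega> \<in> A j \<Longrightarrow> \<bar>f \<omega>\<bar> \<le> 2" for j f
    using that by (intro integrable_bounded[of _ 2]) (auto simp: indicator_def)
  have intR: "integrable M (\<lambda>\<omega>. indicat_real (A j) \<omega> * ?R c \<omega>)" for j c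
    using R by (intro int) (auto simp: abs_of_nonneg)
  have ER: "expectation (?R c) = drifted_max_tail \<gamma> c t" for c
  proof -
    have "expectation (?R c) = (\<integral>v. normal_density (\<gamma> * t) (sqrt t) v * reflection_weight \<gamma> (c - v) \<partial>lborel)"
      using brownian_increment_distributed[OF B order_refl t, of \<gamma>]
      by (intro distributed_integral[symmetric]) (auto simp: X_def)
    then show ?thesis using integral_reflection_weight[OF t] by simp
  qed
  have step: "expectation (\<lambda>\<omega>. indicator (A j) \<omega> * ?R c \<omega>)
      = expectation (\<lambda>\<omega>. indicator (A j) \<omega> * drifted_max_tail \<gamma> (c - X (\<tau> j) \<omega>) (t - \<tau> j))"
    if "j < n" for c j
    unfolding A_def X_def
    by (rule expectation_first_passage[OF B \<gamma> \<tau>(1) _ \<tau>_less[OF that]])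
       (auto simp: mono_on_def strict_mono_less_eq[OF \<tau>(2)])
  have ED: "expectation (\<lambda>\<omega>. indicator D \<omega> * ?R c \<omega>)
      = (\<Sum>j\<le>n. expectation (\<lambda>\<omega>. indicator (A j) \<omega> * ?R c \<omega>))" for c
  proof -
    have "expectation (\<lambda>\<omega>. indicator D \<omega> * ?R c \<omega>)
        = expectation (\<lambda>\<omega>. \<Sum>j\<le>n. indicator (A j) \<omega> * ?R c \<omega>)"
      unfolding ind_D sum_distrib_right by simp
    also have "\<dots> = (\<Sum>j\<le>n. expectation (\<lambda>\<omega>. indicator (A j) \<omega> * ?R c \<omega>))"
      by (intro Bochner_Integration.integral_sum intR)
    finally show ?thesis .
  qed

  show "prob D \<le> drifted_max_tail \<gamma> m t"
  proof -
    \<comment> \<open>Summed over \<open>j\<close>, this bounds \<open>prob D\<close> by the mean of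
      the weight on \<open>D\<close>, hence by its full mean, which is the tail. At
      \<open>j = n\<close> no time remains, so the weight itself is bounded instead of its
      conditional mean.\<close>
    have "prob (A j) \<le> expectation (\<lambda>\<omega>. indicator (A j) \<omega> * ?R m \<omega>)" if j: "j \<le> n" for j
    proof (cases "j = n")
      case True
      have "expectation (\<lambda>\<omega>. indicator (A j) \<omega> * 1) \<le> expectation (\<lambda>\<omega>. indicator (A j) \<omega> * ?R m \<omega>)"
        using True \<tau>(3) by (intro integral_mono int intR) (auto simp: A_def indicator_def intro!: R(3))
      then show ?thesis by simp
    next
      case False
      then have jn: "j < n" using j by simp
      have "expectation (\<lambda>\<omega>. indicator (A j) \<omega> * 1)
          \<le> expectation (\<lambda>\<omega>. indicator (A j) \<omega> * drifted_max_tail \<gamma> (m - X (\<tau> j) \<omega>) (t - \<tau> j))"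
      proof (intro integral_mono int)
        show "(\<lambda>\<omega>. drifted_max_tail \<gamma> (m - X (\<tau> j) \<omega>) (t - \<tau> j)) \<in> borel_measurable M"
          by (rule measurable_compose[OF _ drifted_max_tail_measurable])
            (use \<tau>_less[OF jn] in \<open>auto intro!: borel_measurable_diff X\<tau>\<close>)
        show "\<bar>drifted_max_tail \<gamma> (m - X (\<tau> j) \<omega>) (t - \<tau> j)\<bar> \<le> 2" if "\<omega> \<in> A j" for \<omega>
          using that drifted_max_tail_nonneg drifted_max_tail_le_2[OF \<gamma>] by (simp add: A_def)
        show "indicator (A j) \<omega> * 1
            \<le> indicator (A j) \<omega> * drifted_max_tail \<gamma> (m - X (\<tau> j) \<omega>) (t - \<tau> j)" for \<omega>
          using \<tau>_less[OF jn] drifted_max_tail_ge_1[OF _ \<gamma>, of "t - \<tau> j" "m - X (\<tau> j) \<omega>"]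
          by (simp add: indicator_def A_def)
      qed auto
      then show ?thesis by (simp add: step[OF jn])
    qed
    then have "(\<Sum>j\<le>n. prob (A j)) \<le> expectation (\<lambda>\<omega>. indicator D \<omega> * ?R m \<omega>)"
      unfolding ED by (intro sum_mono) auto
    moreover have "prob D = (\<Sum>j\<le>n. prob (A j))"
    proof -
      have "prob D = expectation (indicator D)" by simp
      also have "\<dots> = (\<Sum>j\<le>n. expectation (\<lambda>\<omega>. indicator (A j) \<omega> * 1))"
        unfolding ind_D[abs_def] by (intro Bochner_Integration.integral_sum int) auto
      finally show ?thesis by simp
    qed
    moreover have "expectation (\<lambda>\<omega>. indicator D \<omega> * ?R m \<omega>) \<le> expectation (?R m)"
      using R by (intro integral_mono integrable_bounded[of _ 2]) (auto simp: indicator_def abs_of_nonneg)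
    ultimately show ?thesis by (simp add: ER)
  qed

  show "drifted_max_tail \<gamma> (m + \<epsilon>) t \<le> prob D + prob E"
  proof -
    define c where "c = m + \<epsilon>"
    \<comment> \<open>An upper bound for the conditional mean of the weight at the first passage
      (for \<open>j = n\<close>, for the weight itself): 1 while the overshoot stays below
      \<open>\<epsilon>\<close>, and the crude 2 otherwise.\<close>
    define J where "J j \<omega> = (1 + indicator {\<omega> \<in> space M. c \<le> X (\<tau> j) \<omega>} \<omega> :: real)" for j \<omega>
    have Jm [measurable]: "J j \<in> borel_measurable M" for j unfolding J_def[abs_def] by measurable
    have J2: "\<bar>J j \<omega>\<bar> \<le> 2" for j \<omega> by (simp add: J_def indicator_def)
    have bound: "expectation (\<lambda>\<omega>. indicator (A j) \<omega> * ?R c \<omega>) \<le> expectation (\<lambda>\<omega>. indicator (A j) \<omega> * J j \<omega>)"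
      if j: "j \<le> n" for j
    proof (cases "j = n")
      case True
      have "?R c \<omega> \<le> J j \<omega>" if "\<omega> \<in> space M" for \<omega>
        using True \<tau>(3) that R(2)[of "c - X t \<omega>"]
        by (cases "c \<le> X t \<omega>") (auto simp: J_def reflection_weight_def[of \<gamma> "c - X t \<omega>"])
      then show ?thesis
        by (intro integral_mono int intR Jm J2 mult_left_mono) auto
    next
      case False
      then have jn: "j < n" using j by simp
      have tail: "drifted_max_tail \<gamma> (c - X (\<tau> j) \<omega>) (t - \<tau> j) \<le> J j \<omega>" if "\<omega> \<in> space M" for \<omega>
        using that \<tau>_less[OF jn] drifted_max_tail_le_2[OF \<gamma>, of "c - X (\<tau> j) \<omega>" "t - \<tau> j"]
          drifted_max_tail_le_1[OF _ \<gamma>, of "t - \<tau> j" "c - X (\<tau> j) \<omega>"]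
        by (simp add: J_def indicator_def)
      have "expectation (\<lambda>\<omega>. indicator (A j) \<omega> * drifted_max_tail \<gamma> (c - X (\<tau> j) \<omega>) (t - \<tau> j))
          \<le> expectation (\<lambda>\<omega>. indicator (A j) \<omega> * J j \<omega>)"
      proof (intro integral_mono int Jm J2 mult_left_mono tail)
        show "(\<lambda>\<omega>. drifted_max_tail \<gamma> (c - X (\<tau> j) \<omega>) (t - \<tau> j)) \<in> borel_measurable M"
          by (rule measurable_compose[OF _ drifted_max_tail_measurable])
            (use \<tau>_less[OF jn] in \<open>auto intro!: borel_measurable_diff X\<tau>\<close>)
        show "\<bar>drifted_max_tail \<gamma> (c - X (\<tau> j) \<omega>) (t - \<tau> j)\<bar> \<le> 2" if "\<omega> \<in> A j" for \<omega>
          using tail[of \<omega>] J2[of j \<omega>] that drifted_max_tail_nonneg by (simp add: A_def abs_le_iff)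
      qed auto
      then show ?thesis by (simp add: step[OF jn])
    qed
    have "drifted_max_tail \<gamma> c t = expectation (?R c)" by (simp add: ER)
    \<comment> \<open>Off \<open>D\<close> the endpoint, being a grid value, lies below
      \<open>m\<close> and so below \<open>c\<close>, where the weight vanishes. Restricting to
      \<open>D\<close> therefore loses nothing.\<close>
    also have "\<dots> = expectation (\<lambda>\<omega>. indicator D \<omega> * ?R c \<omega>)"
    proof (intro Bochner_Integration.integral_cong refl)
      fix \<omega> assume "\<omega> \<in> space M"
      show "?R c \<omega> = indicator D \<omega> * ?R c \<omega>"
      proof (cases "\<omega> \<in> D")
        case False
        then have "X (\<tau> n) \<omega> < m" using \<open>\<omega> \<in> space M\<close> by (auto simp: D_def not_le)
        then show ?thesis using \<epsilon> \<tau>(3) by (simp add: reflection_weight_def c_def)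
      qed simp
    qed
    also have "\<dots> \<le> (\<Sum>j\<le>n. expectation (\<lambda>\<omega>. indicator (A j) \<omega> * J j \<omega>))"
      unfolding ED by (intro sum_mono bound) simp
    also have "\<dots> = expectation (\<lambda>\<omega>. \<Sum>j\<le>n. indicator (A j) \<omega> * J j \<omega>)"
      by (intro Bochner_Integration.integral_sum[symmetric] int Jm J2)
    also have "\<dots> \<le> expectation (\<lambda>\<omega>. indicator D \<omega> + indicator E \<omega>)"
    proof (intro integral_mono)
      fix \<omega> assume \<omega>: "\<omega> \<in> space M"
      show "(\<Sum>j\<le>n. indicator (A j) \<omega> * J j \<omega>) \<le> indicator D \<omega> + indicator E \<omega>"
      proof (cases "\<omega> \<in> D")
        case True
        then obtain j where j: "j \<le> n" "\<omega> \<in> A j" using D_A by blast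
        have "J j \<omega> \<le> 1 + indicator E \<omega>"
        proof (cases "c \<le> X (\<tau> j) \<omega>")
          case c: True
          have "m \<le> X (\<tau> j) \<omega>" using j(2) by (simp add: A_def)
          \<comment> \<open>The path starts at 0, below \<open>m\<close>, so there is a previous
            grid point, and its value is below \<open>m\<close>. Reaching
            \<open>m + \<epsilon>\<close> in one step puts the path in \<open>E\<close>.\<close>
          then have "j \<noteq> 0" using m X0[of \<omega>] by (cases "j = 0") simp_all
          then obtain i where i: "j = Suc i" by (cases j) auto
          then have "X (\<tau> i) \<omega> < m" using j(2) by (simp add: A_def)
          then have "\<omega> \<in> E" using c j i \<omega> by (auto simp: E_def c_def intro!: exI[of _ i])
          then show ?thesis by (simp add: J_def indicator_def)
        qed (simp add: J_def)
        then show ?thesis using True j by (simp add: sum_A[OF j])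
      next
        case False
        show ?thesis unfolding sum_A_0[OF False] by simp
      qed
    next
      show "integrable M (\<lambda>\<omega>. \<Sum>j\<le>n. indicator (A j) \<omega> * J j \<omega>)"
        by (intro Bochner_Integration.integrable_sum int Jm J2)
      show "integrable M (\<lambda>\<omega>. indicat_real D \<omega> + indicat_real E \<omega>)"
        by (intro integrable_bounded[of _ 2]) (auto simp: indicator_def)
    qed
    also have "\<dots> = expectation (indicator D) + expectation (indicator E)"
      by (intro Bochner_Integration.integral_add integrable_bounded[of _ 1]) auto
    also have "\<dots> = prob D + prob E" by simp
    finally show ?thesis by (simp add: c_def)
  qed
qed

end

section \<open>Continuous paths and their values on uniform grids\<close>

lemma grid_hit:
  fixes f :: "real \<Rightarrow> real"
  assumes f: "continuous_on {0..t} f" and t: "0 < t" and s: "0 \<le> s" "s \<le> t" "m < f s"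
  shows "\<forall>\<^sub>F n in sequentially. \<exists>j\<le>Suc n. m \<le> f (t * real j / real (Suc n))"
proof -
  obtain d where d: "d > 0" "\<And>r. r \<in> {0..t} \<Longrightarrow> dist r s < d \<Longrightarrow> dist (f r) (f s) < f s - m"
    using f s unfolding continuous_on_iff by (metis atLeastAtMost_iff diff_gt_0_iff_gt)
  have "(\<lambda>n. t / real (Suc n)) \<longlonglongrightarrow> 0"
    using tendsto_mult[OF tendsto_const LIMSEQ_inverse_real_of_nat, of t] by (simp add: divide_inverse)
  then have "\<forall>\<^sub>F n in sequentially. t / real (Suc n) < d"
    using d(1) by (rule order_tendstoD(2))
  then show ?thesis
  proof eventually_elim
    case (elim n)
    \<comment> \<open>The last grid index whose time does not exceed \<open>s\<close>; the margin
      \<open>f s - m\<close> absorbs the move from \<open>s\<close> to that grid point.\<close>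
    define j where "j = nat \<lfloor>s * real (Suc n) / t\<rfloor>"
    have j: "real j \<le> s * real (Suc n) / t" "s * real (Suc n) / t < real j + 1"
      using s t by (auto simp: j_def)
    have 1: "t * real j / real (Suc n) \<le> s"
      using j(1) t by (simp add: field_simps)
    have "s < t * (real j + 1) / real (Suc n)"
      using j(2) t by (simp add: field_simps del: of_nat_Suc)
    then have 2: "s < t * real j / real (Suc n) + t / real (Suc n)"
      by (simp add: distrib_left add_divide_distrib del: of_nat_Suc)
    have "real j \<le> real (Suc n)"
      using j(1) s(2) t by (smt (verit) divide_le_eq mult.commute mult_right_mono of_nat_0_le_iff)
    then have "j \<le> Suc n" by linarith
    moreover have "dist (f (t * real j / real (Suc n))) (f s) < f s - m"
      using 1 2 elim s t by (intro d(2)) (auto simp: dist_real_def)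
    then have "m \<le> f (t * real j / real (Suc n))" by (simp add: dist_real_def)
    ultimately show ?case by blast
  qed
qed

lemma grid_osc:
  fixes f :: "real \<Rightarrow> real"
  assumes f: "continuous_on {0..t} f" and t: "0 < t" and \<epsilon>: "0 < \<epsilon>"
  shows "\<forall>\<^sub>F n in sequentially. \<forall>j<Suc n.
    f (t * real (Suc j) / real (Suc n)) - f (t * real j / real (Suc n)) < \<epsilon>"
proof -
  have "uniformly_continuous_on {0..t} f"
    using f by (intro compact_uniformly_continuous) auto
  then obtain d where d: "d > 0"
    "\<And>x y. x \<in> {0..t} \<Longrightarrow> y \<in> {0..t} \<Longrightarrow> dist y x < d \<Longrightarrow> dist (f y) (f x) < \<epsilon>"
    using \<epsilon> unfolding uniformly_continuous_on_def by metis
  have "(\<lambda>n. t / real (Suc n)) \<longlonglongrightarrow> 0"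
    using tendsto_mult[OF tendsto_const LIMSEQ_inverse_real_of_nat, of t] by (simp add: divide_inverse)
  then have "\<forall>\<^sub>F n in sequentially. t / real (Suc n) < d"
    using d(1) by (rule order_tendstoD(2))
  then show ?thesis
  proof (eventually_elim, intro allI impI)
    fix n j assume n: "t / real (Suc n) < d" and j: "j < Suc n"
    have "t * real i / real (Suc n) \<in> {0..t}" if "i \<le> Suc n" for i
      using that t mult_left_mono[of "real i" "real (Suc n)" t] by (auto simp: divide_le_eq simp del: of_nat_Suc)
    moreover have "real (Suc j) = real j + 1" by simp
    then have "t * real (Suc j) / real (Suc n) - t * real j / real (Suc n) = t / real (Suc n)"
      by (simp only: distrib_left add_divide_distrib mult_1_right add_diff_cancel_left')
    ultimately have "dist (f (t * real (Suc j) / real (Suc n))) (f (t * real j / real (Suc n))) < \<epsilon>"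
      using n j t by (intro d(2)) (auto simp: dist_real_def simp del: of_nat_Suc)
    then show "f (t * real (Suc j) / real (Suc n)) - f (t * real j / real (Suc n)) < \<epsilon>"
      by (simp add: dist_real_def)
  qed
qed

section \<open>Pathwise comparison of the hitting time with the running maximum\<close>

lemma first_hitting_time_nonempty:
  assumes cont: "continuous_on {0..} (\<lambda>s. B s \<omega>)" and \<delta>: "0 < \<delta>" and t: "0 \<le> t"
  shows "\<exists>s\<ge>0. inverse_gaussian_subordinator \<delta> \<gamma> B s \<omega> > ereal t"
proof -
  have "continuous_on {0..t + 1} (\<lambda>s. B s \<omega> + \<gamma> * s)"
    by (intro continuous_intros continuous_on_subset[OF cont]) auto
  then have "bounded ((\<lambda>s. B s \<omega> + \<gamma> * s) ` {0..t + 1})"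
    by (intro compact_imp_bounded compact_continuous_image) auto
  then obtain K where "\<forall>s\<in>{0..t + 1}. norm (B s \<omega> + \<gamma> * s) \<le> K"
    unfolding bounded_iff by blast
  then have K: "\<bar>B s \<omega> + \<gamma> * s\<bar> \<le> K" if "s \<in> {0..t + 1}" for s
    using that by simp
  have K0: "0 \<le> K" using K[of 0] t by simp
  \<comment> \<open>At the argument \<open>K / \<delta>\<close> the threshold is \<open>K\<close>,
    which the path cannot exceed up to time \<open>t + 1\<close>; the extra unit of time yields the
    strict inequality.\<close>
  have "ereal (t + 1) \<le> inverse_gaussian_subordinator \<delta> \<gamma> B (K / \<delta>) \<omega>"
    unfolding inverse_gaussian_subordinator_def
  proof (rule Inf_greatest, clarify)
    fix s :: real assume s: "0 < s" "\<delta> * (K / \<delta>) < B s \<omega> + \<gamma> * s"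
    then show "ereal (t + 1) \<le> ereal s"
      using K[of s] \<delta> by (cases "s \<le> t + 1") auto
  qed
  moreover have "ereal t < ereal (t + 1)" by simp
  ultimately have "ereal t < inverse_gaussian_subordinator \<delta> \<gamma> B (K / \<delta>) \<omega>"
    by (rule less_le_trans[rotated])
  then show ?thesis using K0 \<delta> by (intro exI[of _ "K / \<delta>"]) simp
qed

lemma first_hitting_time_nonneg:
  assumes "continuous_on {0..} (\<lambda>s. B s \<omega>)" "0 < \<delta>" "0 \<le> t"
  shows "0 \<le> first_hitting_time (inverse_gaussian_subordinator \<delta> \<gamma> B) t \<omega>"
  unfolding first_hitting_time_def
  using first_hitting_time_nonempty[of B \<omega>, OF assms] by (intro cInf_greatest) auto

text \<open>For \<open>s < x\<close> the path at time \<open>r\<close> is strictly above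
  \<open>\<delta> * s\<close>, so the subordinator at \<open>s\<close> is at most \<open>r\<close>,
  hence at most \<open>t\<close>, and \<open>s\<close> is excluded from the infimum. Positivity of
  \<open>r\<close> matters because the subordinator only looks at positive times.\<close>

lemma first_hitting_time_geI:
  assumes cont: "continuous_on {0..} (\<lambda>s. B s \<omega>)" and \<delta>: "0 < \<delta>"
    and r: "0 < r" "r \<le> t" "\<delta> * x \<le> B r \<omega> + \<gamma> * r"
  shows "x \<le> first_hitting_time (inverse_gaussian_subordinator \<delta> \<gamma> B) t \<omega>"
  unfolding first_hitting_time_def
proof (rule cInf_greatest)
  show "{s. 0 \<le> s \<and> ereal t < inverse_gaussian_subordinator \<delta> \<gamma> B s \<omega>} \<noteq> {}"
    using first_hitting_time_nonempty[of B \<omega>, OF cont \<delta>, of t] r by auto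
  fix s assume "s \<in> {s. 0 \<le> s \<and> ereal t < inverse_gaussian_subordinator \<delta> \<gamma> B s \<omega>}"
  then have s: "ereal t < inverse_gaussian_subordinator \<delta> \<gamma> B s \<omega>" by simp
  show "x \<le> s"
  proof (rule ccontr)
    assume "\<not> x \<le> s"
    then have "\<delta> * s < B r \<omega> + \<gamma> * r"
      using \<delta> r(3) by (smt (verit) mult_strict_left_mono)
    then have "inverse_gaussian_subordinator \<delta> \<gamma> B s \<omega> \<le> ereal r"
      unfolding inverse_gaussian_subordinator_def using r(1) by (intro Inf_lower) auto
    with s r(2) show False by (meson ereal_less_eq(3) leD order.trans)
  qed
qed

text \<open>By contraposition: if the path stays below \<open>\<delta> * x\<close> up to
  \<open>t\<close>, continuity keeps it there for a time \<open>d\<close> longer, so the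
  subordinator at \<open>x\<close> exceeds \<open>t\<close> and the hitting time is at most
  \<open>x\<close>.\<close>

lemma first_hitting_time_gtD:
  assumes cont: "continuous_on {0..} (\<lambda>s. B s \<omega>)" and t: "0 < t" and x: "0 \<le> x"
    and H: "x < first_hitting_time (inverse_gaussian_subordinator \<delta> \<gamma> B) t \<omega>"
  shows "\<exists>s\<in>{0..t}. \<delta> * x \<le> B s \<omega> + \<gamma> * s"
proof (rule ccontr)
  assume "\<not> ?thesis"
  then have less: "B s \<omega> + \<gamma> * s < \<delta> * x" if "0 \<le> s" "s \<le> t" for s
    using that by (meson atLeastAtMost_iff not_le)
  have "continuous_on {0..} (\<lambda>s. B s \<omega> + \<gamma> * s)"
    by (intro continuous_intros cont)
  moreover have "0 < \<delta> * x - (B t \<omega> + \<gamma> * t)" using less[of t] t by simp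
  ultimately obtain d where d: "d > 0" "\<And>s. s \<in> {0..} \<Longrightarrow> dist s t < d \<Longrightarrow>
      dist (B s \<omega> + \<gamma> * s) (B t \<omega> + \<gamma> * t) < \<delta> * x - (B t \<omega> + \<gamma> * t)"
    using t unfolding continuous_on_iff by (metis atLeast_iff less_imp_le)
  have "ereal (t + d) \<le> inverse_gaussian_subordinator \<delta> \<gamma> B x \<omega>"
    unfolding inverse_gaussian_subordinator_def
  proof (rule Inf_greatest, clarify)
    fix s :: real assume s: "0 < s" "\<delta> * x < B s \<omega> + \<gamma> * s"
    then have "t < s" using less[of s] by (cases "s \<le> t") auto
    moreover have "\<not> dist s t < d"
      using d(2)[of s] s by (auto simp: dist_real_def)
    ultimately show "ereal (t + d) \<le> ereal s" by (simp add: dist_real_def)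
  qed
  moreover have "ereal t < ereal (t + d)" using d(1) by simp
  ultimately have "ereal t < inverse_gaussian_subordinator \<delta> \<gamma> B x \<omega>"
    by (rule less_le_trans[rotated])
  then have "first_hitting_time (inverse_gaussian_subordinator \<delta> \<gamma> B) t \<omega> \<le> x"
    unfolding first_hitting_time_def using x by (intro cInf_lower) (auto intro!: bdd_belowI[of _ 0])
  with H show False by simp
qed

section \<open>Tail and density of the hitting time\<close>

context prob_space
begin

text \<open>The events in the two bounds differ by \<open>H = x\<close>: an atom there is not yet
  excluded. The gap closes once a density is available.\<close>

lemma prob_hitting_time_tail:
  assumes B: "standard_brownian_motion B" and \<gamma>: "0 \<le> \<gamma>" and \<delta>: "0 < \<delta>" and t: "0 < t" and x: "0 < x"
  defines "H \<equiv> first_hitting_time (inverse_gaussian_subordinator \<delta> \<gamma> B) t"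
  assumes Hm [measurable]: "H \<in> borel_measurable M"
  shows "prob {\<omega> \<in> space M. x < H \<omega>} \<le> drifted_max_tail \<gamma> (\<delta> * x) t"
    and "drifted_max_tail \<gamma> (\<delta> * x) t \<le> prob {\<omega> \<in> space M. x \<le> H \<omega>}"
proof -
  define X where "X s \<omega> = B s \<omega> - B 0 \<omega> + \<gamma> * s" for s \<omega>
  define \<tau> where "\<tau> n j = t * real j / real (Suc n)" for n j
  define D where "D m n = {\<omega> \<in> space M. \<exists>j\<le>Suc n. m \<le> X (\<tau> n j) \<omega>}" for m n
  define E where "E \<epsilon> n = {\<omega> \<in> space M. \<exists>j<Suc n. \<epsilon> \<le> X (\<tau> n (Suc j)) \<omega> - X (\<tau> n j) \<omega>}" for \<epsilon> n
  have cont: "continuous_on {0..} (\<lambda>s. B s \<omega>)" if "\<omega> \<in> space M" for \<omega>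
    using B that unfolding standard_brownian_motion_def by blast
  have contX: "continuous_on {0..t} (\<lambda>s. X s \<omega>)" if "\<omega> \<in> space M" for \<omega>
    unfolding X_def by (intro continuous_intros continuous_on_subset[OF cont[OF that]]) auto
  have B0: "AE \<omega> in M. B 0 \<omega> = 0"
    using B unfolding standard_brownian_motion_def by blast
  have \<tau>: "\<tau> n 0 = 0" "strict_mono (\<tau> n)" "\<tau> n (Suc n) = t" for n
    using t by (auto simp: \<tau>_def strict_mono_def intro!: divide_strict_right_mono mult_strict_left_mono)
  have \<tau>_nonneg: "0 \<le> \<tau> n j" for n j using t by (simp add: \<tau>_def)
  have [measurable]: "X (\<tau> n j) \<in> borel_measurable M" for n j
    using B \<tau>_nonneg[of n j] unfolding X_def standard_brownian_motion_def by (auto intro!: borel_measurable_add borel_measurable_diff)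
  have [measurable]: "D m n \<in> events" "E \<epsilon> n \<in> events" for m n \<epsilon>
    unfolding D_def E_def by measurable
  have [measurable]: "{\<omega> \<in> space M. x < H \<omega>} \<in> events" "{\<omega> \<in> space M. x \<le> H \<omega>} \<in> events"
    by measurable
  note grid = first_passage_grid_bounds[OF B \<gamma> _ _ \<tau>(1,2,3), folded X_def, folded D_def E_def]
  have cont_tail: "isCont (\<lambda>m. drifted_max_tail \<gamma> m t) y" for y
    by (rule DERIV_isCont[OF DERIV_drifted_max_tail_space[OF t]])
  have \<delta>x: "0 < \<delta> * x" using \<delta> x by simp

  show "prob {\<omega> \<in> space M. x < H \<omega>} \<le> drifted_max_tail \<gamma> (\<delta> * x) t"
  proof -
    \<comment> \<open>The path is only known to reach \<open>\<delta> * x\<close>, while a fine grid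
      is only sure to detect levels strictly below the maximum. Hence an auxiliary level
      \<open>m\<close>, sent to \<open>\<delta> * x\<close> from below at the end.\<close>
    have le: "prob {\<omega> \<in> space M. x < H \<omega>} \<le> drifted_max_tail \<gamma> m t" if m: "0 < m" "m < \<delta> * x" for m
    proof -
      define A where "A n = {\<omega> \<in> space M. x < H \<omega>} - D m n" for n
      have [measurable]: "A n \<in> events" for n unfolding A_def by measurable
      have "AE \<omega> in M. \<forall>\<^sub>F n in sequentially. \<omega> \<notin> A n"
        using B0 AE_space
      proof eventually_elim
        case (elim \<omega>)
        show ?case
        proof (cases "x < H \<omega>")
          case True
          then obtain s where s: "s \<in> {0..t}" "\<delta> * x \<le> B s \<omega> + \<gamma> * s"
            using first_hitting_time_gtD[of B \<omega> t x \<delta> \<gamma>] cont[OF elim(2)] t x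
            unfolding H_def by auto
          then have "m < X s \<omega>" using m elim(1) by (simp add: X_def)
          then have "\<forall>\<^sub>F n in sequentially. \<exists>j\<le>Suc n. m \<le> X (\<tau> n j) \<omega>"
            unfolding \<tau>_def using s(1) by (intro grid_hit[OF contX[OF elim(2)] t, of s]) auto
          then show ?thesis
            by (rule eventually_mono) (use elim(2) in \<open>auto simp: A_def D_def\<close>)
        qed (simp add: A_def)
      qed
      then have "(\<lambda>n. prob (A n)) \<longlonglongrightarrow> 0"
        by (intro prob_eventually_not_in) auto
      then have lim: "(\<lambda>n. drifted_max_tail \<gamma> m t + prob (A n)) \<longlonglongrightarrow> drifted_max_tail \<gamma> m t + 0"
        by (intro tendsto_add tendsto_const)
      have "prob {\<omega> \<in> space M. x < H \<omega>} \<le> drifted_max_tail \<gamma> m t + prob (A n)" for n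
      proof -
        have "prob {\<omega> \<in> space M. x < H \<omega>} \<le> prob (D m n \<union> A n)"
          by (intro finite_measure_mono) (auto simp: A_def)
        also have "\<dots> \<le> prob (D m n) + prob (A n)"
          by (rule measure_Un_le) auto
        also have "prob (D m n) \<le> drifted_max_tail \<gamma> m t"
          by (rule grid(1)[of _ 1]) (use m in auto)
        finally show ?thesis by simp
      qed
      then show ?thesis
        using LIMSEQ_le_const[OF lim] by simp
    qed
    have "((\<lambda>m. drifted_max_tail \<gamma> m t) \<longlongrightarrow> drifted_max_tail \<gamma> (\<delta> * x) t) (at_left (\<delta> * x))"
      using cont_tail by (simp add: isCont_def filterlim_at_split)
    moreover have "\<forall>\<^sub>F m in at_left (\<delta> * x). prob {\<omega> \<in> space M. x < H \<omega>} \<le> drifted_max_tail \<gamma> m t"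
      by (rule eventually_mono[OF eventually_at_left_real[OF \<delta>x]]) (simp add: le)
    ultimately show ?thesis
      by (rule tendsto_lowerbound) simp
  qed

  show "drifted_max_tail \<gamma> (\<delta> * x) t \<le> prob {\<omega> \<in> space M. x \<le> H \<omega>}"
  proof -
    \<comment> \<open>The order of limits matters: uniform continuity makes
      \<open>E \<epsilon> n\<close> negligible for fixed \<open>\<epsilon>\<close> as the mesh
      shrinks, and only then does \<open>\<epsilon>\<close> tend to 0.\<close>
    have le: "drifted_max_tail \<gamma> (\<delta> * x + \<epsilon>) t \<le> prob {\<omega> \<in> space M. x \<le> H \<omega>}" if \<epsilon>: "0 < \<epsilon>" for \<epsilon>
    proof -
      have "AE \<omega> in M. \<forall>\<^sub>F n in sequentially. \<omega> \<notin> E \<epsilon> n"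
      proof (rule AE_I2)
        fix \<omega> assume \<omega>: "\<omega> \<in> space M"
        show "\<forall>\<^sub>F n in sequentially. \<omega> \<notin> E \<epsilon> n"
          by (rule eventually_mono[OF grid_osc[OF contX[OF \<omega>] t \<epsilon>]]) (auto simp: E_def \<tau>_def not_le)
      qed
      then have "(\<lambda>n. prob (E \<epsilon> n)) \<longlonglongrightarrow> 0"
        by (intro prob_eventually_not_in) auto
      then have lim: "(\<lambda>n. prob {\<omega> \<in> space M. x \<le> H \<omega>} + prob (E \<epsilon> n)) \<longlonglongrightarrow> prob {\<omega> \<in> space M. x \<le> H \<omega>} + 0"
        by (intro tendsto_add tendsto_const)
      have "drifted_max_tail \<gamma> (\<delta> * x + \<epsilon>) t \<le> prob {\<omega> \<in> space M. x \<le> H \<omega>} + prob (E \<epsilon> n)" for n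
      proof -
        have "AE \<omega> in M. \<omega> \<in> D (\<delta> * x) n \<longrightarrow> \<omega> \<in> {\<omega> \<in> space M. x \<le> H \<omega>}"
          using B0 AE_space
        proof eventually_elim
          case (elim \<omega>)
          show ?case
          proof
            assume "\<omega> \<in> D (\<delta> * x) n"
            then obtain j where j: "j \<le> Suc n" "\<delta> * x \<le> X (\<tau> n j) \<omega>" by (auto simp: D_def)
            \<comment> \<open>At time 0 the process is 0, below the positive level; this supplies
              the positive time that \<open>first_hitting_time_geI\<close> asks for.\<close>
            have "\<tau> n j \<noteq> 0" using j(2) \<delta>x by (auto simp: X_def)
            then have "0 < \<tau> n j" using \<tau>_nonneg[of n j] by simp
            moreover have "\<tau> n j \<le> t"
              using j(1) strict_mono_less_eq[OF \<tau>(2), of n j "Suc n"] \<tau>(3)[of n] by simp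
            ultimately have "x \<le> H \<omega>"
              unfolding H_def using j(2) elim(1)
              by (intro first_hitting_time_geI[of B \<omega> \<delta> "\<tau> n j"] cont elim(2) \<delta>) (auto simp: X_def)
            then show "\<omega> \<in> {\<omega> \<in> space M. x \<le> H \<omega>}" using elim(2) by simp
          qed
        qed
        then have "prob (D (\<delta> * x) n) \<le> prob {\<omega> \<in> space M. x \<le> H \<omega>}"
          by (intro finite_measure_mono_AE) auto
        moreover have "drifted_max_tail \<gamma> (\<delta> * x + \<epsilon>) t \<le> prob (D (\<delta> * x) n) + prob (E \<epsilon> n)"
          by (rule grid(2)) (use \<delta>x \<epsilon> in auto)
        ultimately show ?thesis by simp
      qed
      then show ?thesis
        using LIMSEQ_le_const[OF lim] by simp
    qed
    have "((\<lambda>\<epsilon>. drifted_max_tail \<gamma> (\<delta> * x + \<epsilon>) t) \<longlongrightarrow> drifted_max_tail \<gamma> (\<delta> * x + 0) t) (at_right 0)"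
      by (rule isCont_tendsto_compose[OF cont_tail]) (intro tendsto_intros)
    moreover have "\<forall>\<^sub>F \<epsilon> in at_right 0. drifted_max_tail \<gamma> (\<delta> * x + \<epsilon>) t \<le> prob {\<omega> \<in> space M. x \<le> H \<omega>}"
      by (rule eventually_mono[OF eventually_at_right_less]) (simp add: le)
    ultimately have "drifted_max_tail \<gamma> (\<delta> * x + 0) t \<le> prob {\<omega> \<in> space M. x \<le> H \<omega>}"
      by (rule tendsto_upperbound) simp
    then show ?thesis by simp
  qed
qed

text \<open>Both sides are the derivative at \<open>x\<close> of the same increment of the tail.
  Continuity of \<open>f\<close> gives this at every \<open>x > 0\<close> instead of almost
  everywhere.\<close>

lemma continuous_density_eq_hitting_density:
  assumes B: "standard_brownian_motion B" and \<gamma>: "0 \<le> \<gamma>" and \<delta>: "0 < \<delta>" and t: "0 < t" and x: "0 < x"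
    and f: "has_continuous_density_on_pos (first_hitting_time (inverse_gaussian_subordinator \<delta> \<gamma> B) t) f"
  shows "f x = hitting_density \<delta> \<gamma> x t"
proof -
  let ?H = "first_hitting_time (inverse_gaussian_subordinator \<delta> \<gamma> B) t"
  let ?T = "\<lambda>x. drifted_max_tail \<gamma> (\<delta> * x) t"
  have D: "distributed M lborel ?H (\<lambda>x. ennreal (indicator {0<..} x * f x))"
    and f0: "\<And>x. 0 < x \<Longrightarrow> 0 \<le> f x" and fc: "continuous_on {0<..} f"
    using f unfolding has_continuous_density_on_pos_def by auto
  have Hm [measurable]: "?H \<in> borel_measurable M" using distributed_measurable[OF D] by simp
  \<comment> \<open>A positive base point, because \<open>f\<close> is controlled only on the
    positive half-line.\<close>
  define a where "a = x / 2"
  have a: "0 < a" "a < x" using x by (auto simp: a_def)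
  have tail: "prob {\<omega> \<in> space M. y < ?H \<omega>} = ?T y" if "0 < y" for y
  proof -
    \<comment> \<open>A law with a density has no atoms, so the two tail bounds meet.\<close>
    have "AE \<omega> in M. ?H \<omega> \<noteq> y"
      using distributed_AE2[OF D, of "\<lambda>z. z \<noteq> y"] AE_lborel_singleton[of y] by auto
    then have "prob {\<omega> \<in> space M. y \<le> ?H \<omega>} = prob {\<omega> \<in> space M. y < ?H \<omega>}"
      by (intro finite_measure_eq_AE) auto
    then show ?thesis
      using prob_hitting_time_tail[OF B \<gamma> \<delta> t that Hm] by simp
  qed
  have eq: "integral {a..y} f = ?T a - ?T y" if y: "a < y" for y
  proof -
    have cf: "continuous_on {a..y} f"
      by (rule continuous_on_subset[OF fc]) (use a in auto)
    have "?T a - ?T y = prob ({\<omega> \<in> space M. a < ?H \<omega>} - {\<omega> \<in> space M. y < ?H \<omega>})"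
      using a y by (subst finite_measure_Diff) (auto simp: tail)
    also have "\<dots> = expectation (\<lambda>\<omega>. indicat_real {a<..y} (?H \<omega>))"
    proof -
      have "{\<omega> \<in> space M. a < ?H \<omega>} - {\<omega> \<in> space M. y < ?H \<omega>} = ?H -` {a<..y} \<inter> space M" by auto
      moreover have "expectation (\<lambda>\<omega>. indicat_real {a<..y} (?H \<omega>)) = expectation (indicat_real (?H -` {a<..y} \<inter> space M))"
        by (intro Bochner_Integration.integral_cong) (auto simp: indicator_def)
      ultimately show ?thesis by simp
    qed
    also have "\<dots> = (\<integral>z. (indicator {0<..} z * f z) * indicator {a<..y} z \<partial>lborel)"
      by (rule distributed_integral[OF D, symmetric]) (use f0 in \<open>auto simp: indicator_def\<close>)
    also have "\<dots> = (LINT z:{a..y}|lborel. f z)"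
      unfolding set_lebesgue_integral_def
    proof (rule integral_cong_AE)
      show "AE z in lborel. (indicator {0<..} z * f z) * indicator {a<..y} z = indicator {a..y} z *\<^sub>R f z"
        by (rule eventually_mono[OF AE_lborel_singleton[of a]]) (use a in \<open>auto simp: indicator_def\<close>)
      show "(\<lambda>z. indicator {a..y} z *\<^sub>R f z) \<in> borel_measurable lborel"
        using borel_integrable_atLeastAtMost'[OF cf] unfolding set_integrable_def by auto
      show "(\<lambda>z. (indicator {0<..} z * f z) * indicator {a<..y} z) \<in> borel_measurable lborel"
        by (intro borel_measurable_times distributed_real_measurable[OF _ D])
          (use f0 in \<open>auto simp: indicator_def\<close>)
    qed
    also have "\<dots> = integral {a..y} f"
      by (intro set_borel_integral_eq_integral borel_integrable_atLeastAtMost' cf)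
    finally show ?thesis by simp
  qed
  have "((\<lambda>y. integral {a..y} f) has_real_derivative f x) (at x within {a..x + 1})"
    by (rule integral_has_real_derivative[OF continuous_on_subset[OF fc]]) (use a in auto)
  then have "((\<lambda>y. integral {a..y} f) has_real_derivative f x) (at x)"
    by (subst (asm) at_within_interior) (use a in auto)
  then have 1: "((\<lambda>y. ?T a - ?T y) has_real_derivative f x) (at x)"
    by (rule has_field_derivative_transform_within_open[where S = "{a<..}"]) (use a eq in auto)
  have 2: "((\<lambda>y. ?T a - ?T y) has_real_derivative hitting_density \<delta> \<gamma> x t) (at x)"
    by (rule DERIV_cong[OF DERIV_diff[OF DERIV_const
          DERIV_chain2[OF DERIV_drifted_max_tail_space[OF t] DERIV_cmult_Id]]])
      (simp add: hitting_density_def)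
  show ?thesis using DERIV_unique[OF 1 2] .
qed

end

subsection \<open>Poisson probabilities and subordination\<close>

text \<open>With an integer index and value 0 below index 0, the derivative rule has no exceptional
  case at \<open>k = 0\<close>. The formula is kept on the whole real line, so it is differentiable
  at 0 from both sides.\<close>

definition poisson_weight :: "real \<Rightarrow> int \<Rightarrow> real \<Rightarrow> real" where
  "poisson_weight lam k x
    = (if k < 0 then 0 else (lam * x) ^ nat k / fact (nat k) * exp (- (lam * x)))"

lemma DERIV_poisson_weight:
  "(poisson_weight lam k has_real_derivative
     lam * (poisson_weight lam (k - 1) x - poisson_weight lam k x)) (at x)"
proof (cases "k < 0")
  case True
  then show ?thesis by (simp add: poisson_weight_def[abs_def])
next
  case False
  then obtain n where k: "k = int n" by (metis not_less nonneg_int_cases)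
  show ?thesis
  proof (cases n)
    case 0
    then show ?thesis
      unfolding poisson_weight_def[abs_def] k by (auto intro!: derivative_eq_intros)
  next
    case (Suc m)
    have *: "((\<lambda>x. (lam * x) ^ Suc m / fact (Suc m) * exp (- (lam * x))) has_real_derivative
        lam * ((lam * x) ^ m / fact m * exp (- (lam * x)) - (lam * x) ^ Suc m / fact (Suc m) * exp (- (lam * x)))) (at x)"
    proof -
      have "((\<lambda>x. (lam * x) ^ Suc m) has_real_derivative real (Suc m) * lam * (lam * x) ^ m) (at x)"
        by (auto intro!: derivative_eq_intros simp del: power_Suc)
      then have d1: "((\<lambda>x. (lam * x) ^ Suc m / fact (Suc m)) has_real_derivative lam * (lam * x) ^ m / fact m) (at x)"
        by (rule DERIV_cong[OF DERIV_cdivide]) (simp add: field_simps del: of_nat_Suc)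
      have d2: "((\<lambda>x. exp (- (lam * x))) has_real_derivative - lam * exp (- (lam * x))) (at x)"
        by (auto intro!: derivative_eq_intros)
      show ?thesis
        by (rule DERIV_cong[OF DERIV_mult[OF d1 d2]]) (simp add: algebra_simps)
    qed
    have k': "nat k = Suc m" "nat (k - 1) = m" "\<not> k < 0" "\<not> k - 1 < 0" using k Suc by auto
    show ?thesis
      using * unfolding poisson_weight_def[abs_def] k' by (simp only: k' if_False)
  qed
qed

lemma isCont_poisson_weight: "isCont (poisson_weight lam k) x"
  by (rule DERIV_isCont[OF DERIV_poisson_weight])

lemma poisson_weight_measurable [measurable]: "poisson_weight lam k \<in> borel_measurable borel"
  by (intro borel_measurable_continuous_onI continuous_at_imp_continuous_on ballI isCont_poisson_weight)

lemma poisson_weight_bounds: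
  assumes "0 < lam" "0 \<le> x"
  shows "0 \<le> poisson_weight lam k x" "poisson_weight lam k x \<le> 1"
proof -
  show "0 \<le> poisson_weight lam k x" using assms by (simp add: poisson_weight_def)
  show "poisson_weight lam k x \<le> 1"
  proof (cases "x = 0")
    case True
    then show ?thesis by (simp add: poisson_weight_def power_0_left)
  next
    case False
    then have "0 < lam * x" using assms by simp
    then show ?thesis
      using pmf_le_1[of "poisson_pmf (lam * x)" "nat k"] by (simp add: poisson_weight_def)
  qed
qed

lemma poisson_weight_at_top:
  assumes "0 < lam"
  shows "(poisson_weight lam k \<longlongrightarrow> 0) at_top"
proof -
  have "((\<lambda>y::real. y ^ nat k * exp (- y)) \<longlongrightarrow> 0) at_top"
    using tendsto_power_div_exp_0[of "nat k"] by (simp add: exp_minus divide_inverse)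
  moreover have "filterlim (\<lambda>x. lam * x) at_top at_top" using assms by real_asymp
  ultimately have "((\<lambda>x. (lam * x) ^ nat k * exp (- (lam * x))) \<longlongrightarrow> 0) at_top"
    by (rule filterlim_compose)
  from tendsto_mult_right_zero[OF this, of "1 / fact (nat k)"] show ?thesis
    by (cases "k < 0") (simp_all add: poisson_weight_def[abs_def])
qed

text \<open>For \<open>k \<ge> 0\<close> the weight on the positive half-line is the probability
  density \<open>erlang_density (nat k) lam\<close> divided by \<open>lam\<close>.\<close>

lemma set_integrable_poisson_weight:
  assumes "0 < lam"
  shows "set_integrable lborel {0<..} (poisson_weight lam k)"
proof -
  interpret prob_space "density lborel (erlang_density (nat k) lam)"
    using assms by (rule prob_space_erlang_density)
  have "integrable (density lborel (erlang_density (nat k) lam)) (\<lambda>_. 1 :: real)" by simp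
  then have int: "integrable lborel (erlang_density (nat k) lam)"
    using assms by (subst (asm) integrable_density) auto
  have "integrable lborel (\<lambda>x. indicator {0<..} x *\<^sub>R (of_bool (0 \<le> k) * erlang_density (nat k) lam x / lam))"
    using int by (intro integrable_mult_indicator) auto
  also have "(\<lambda>x. indicator {0<..} x *\<^sub>R (of_bool (0 \<le> k) * erlang_density (nat k) lam x / lam))
      = (\<lambda>x. indicator {0<..} x *\<^sub>R poisson_weight lam k x)"
    using assms by (auto simp: fun_eq_iff indicator_def erlang_density_def poisson_weight_def power_mult_distrib)
  finally show ?thesis by (simp add: set_integrable_def)
qed

text \<open>The \<open>+ 1\<close> places the grid time strictly to the right of \<open>h\<close>
  even when \<open>h\<close> is itself a grid point, which fits the right-continuity of the Poisson
  paths.\<close>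

lemma filterlim_floor_grid:
  assumes "0 \<le> h"
  shows "filterlim (\<lambda>n. (real (nat \<lfloor>real (Suc n) * h\<rfloor>) + 1) / real (Suc n)) (at_right h) sequentially"
proof -
  let ?\<tau> = "\<lambda>n. (real (nat \<lfloor>real (Suc n) * h\<rfloor>) + 1) / real (Suc n)"
  have bounds: "h < ?\<tau> n" "?\<tau> n \<le> h + 1 / real (Suc n)" for n
  proof -
    define j where "j = real (nat \<lfloor>real (Suc n) * h\<rfloor>)"
    have "0 \<le> real (Suc n) * h" using assms by simp
    then have j: "j \<le> real (Suc n) * h" "real (Suc n) * h < j + 1" by (auto simp: j_def)
    show "h < ?\<tau> n" using j(2) unfolding j_def[symmetric] by (simp add: field_simps del: of_nat_Suc)
    show "?\<tau> n \<le> h + 1 / real (Suc n)"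
      using j(1) unfolding j_def[symmetric] by (simp add: field_simps del: of_nat_Suc)
  qed
  have "(\<lambda>n. h + inverse (real (Suc n))) \<longlonglongrightarrow> h"
    by (rule LIMSEQ_inverse_real_of_nat_add)
  then have lim: "(\<lambda>n. h + 1 / real (Suc n)) \<longlonglongrightarrow> h" by (simp only: inverse_eq_divide)
  have "?\<tau> \<longlonglongrightarrow> h"
    by (rule tendsto_sandwich[OF _ _ tendsto_const lim])
      (intro always_eventually allI less_imp_le bounds)+
  then show ?thesis
    by (rule tendsto_imp_filterlim_at_right) (intro always_eventually allI bounds)
qed

context prob_space
begin

lemma poisson_prob_eq:
  assumes N: "poisson_process lam N" and lam: "0 < lam" and x: "0 \<le> x"
  shows "poisson_prob N k x = poisson_weight lam (int k) x"
proof -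
  have N0: "AE \<omega> in M. N 0 \<omega> = 0"
    using N unfolding poisson_process_def by blast
  have [measurable]: "N x \<in> measurable M (count_space UNIV)" "N 0 \<in> measurable M (count_space UNIV)"
    using N x unfolding poisson_process_def by auto
  show ?thesis
  proof (cases "x = 0")
    case True
    have "poisson_prob N k x = prob {\<omega> \<in> space M. 0 = k}"
      unfolding poisson_prob_def True by (intro finite_measure_eq_AE) (use N0 in auto)
    also have "\<dots> = poisson_weight lam (int k) x"
      by (cases "k = 0") (auto simp: poisson_weight_def True prob_space)
    finally show ?thesis .
  next
    case False
    then have x: "0 < x" using x by simp
    then have d: "distr M (count_space UNIV) (\<lambda>\<omega>. N x \<omega> - N 0 \<omega>) = measure_pmf (poisson_pmf (lam * x))"
      using N unfolding poisson_process_def by (metis diff_zero order_refl)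
    have "poisson_prob N k x = prob ((\<lambda>\<omega>. N x \<omega> - N 0 \<omega>) -` {k} \<inter> space M)"
      unfolding poisson_prob_def by (intro finite_measure_eq_AE) (use N0 in auto)
    also have "\<dots> = measure (distr M (count_space UNIV) (\<lambda>\<omega>. N x \<omega> - N 0 \<omega>)) {k}"
      by (rule measure_distr[symmetric]) auto
    also have "\<dots> = poisson_weight lam (int k) x"
      unfolding d using x lam by (simp add: measure_pmf_single poisson_weight_def)
    finally show ?thesis .
  qed
qed

text \<open>
  Independence is stated on the product \<open>\<sigma>\<close>-algebra, in which \<open>N (H t)\<close> is not measurable; it is the
  limit of \<open>N\<close> at grid times decreasing to \<open>H t\<close>.
\<close>

lemma subordinated_prob_eq_expectation:
  assumes N: "poisson_process lam N" and lam: "0 < lam" and t: "0 \<le> t"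
    and ind: "indep_processes H (\<lambda>x \<omega>. real (N x \<omega>))"
    and H: "\<And>\<omega>. \<omega> \<in> space M \<Longrightarrow> 0 \<le> H t \<omega>"
  shows "subordinated_prob N H k t = expectation (\<lambda>\<omega>. poisson_weight lam k (H t \<omega>))"
proof (cases "k < 0")
  case True
  then show ?thesis by (simp add: subordinated_prob_def poisson_weight_def)
next
  case False
  then obtain m where k: "k = int m" by (metis not_less nonneg_int_cases)
  define \<tau> where "\<tau> n h = (real (nat \<lfloor>real (Suc n) * h\<rfloor>) + 1) / real (Suc n)" for n and h :: real
  have \<tau>_nonneg: "0 \<le> \<tau> n h" for n h by (simp add: \<tau>_def)
  define S where "S = (\<Pi>\<^sub>M s\<in>{0::real..}. (borel :: real measure))"
  let ?U = "\<lambda>\<omega>. \<lambda>s\<in>{0..}. H s \<omega>" and ?V = "\<lambda>\<omega>. \<lambda>s\<in>{0..}. real (N s \<omega>)"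
  have UV: "indep_var S ?U S ?V" using ind by (simp add: indep_processes_def S_def)
  have comp: "(\<lambda>u. u s) \<in> borel_measurable S" if "0 \<le> s" for s
    unfolding S_def using that by (intro measurable_component_singleton) simp
  have Hm [measurable]: "H t \<in> borel_measurable M"
    using measurable_compose[OF indep_var_rv1[OF UV] comp[OF t]] t by simp
  have cont: "continuous (at_right s) (\<lambda>s. N s \<omega>)" if "\<omega> \<in> space M" "0 \<le> s" for s \<omega>
    using N that unfolding poisson_process_def by blast
  have \<tau>_lim: "filterlim (\<lambda>n. \<tau> n (H t \<omega>)) (at_right (H t \<omega>)) sequentially" if "\<omega> \<in> space M" for \<omega>
    unfolding \<tau>_def by (rule filterlim_floor_grid[OF H[OF that]])
  have \<tau>_meas [measurable]: "\<tau> n \<in> borel_measurable borel" for n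
    unfolding \<tau>_def[abs_def] by measurable
  define J :: "nat \<Rightarrow> 'a \<Rightarrow> real" where "J n \<omega> = of_bool (N (\<tau> n (H t \<omega>)) \<omega> = m)" for n \<omega>
  define L :: "'a \<Rightarrow> real" where "L \<omega> = of_bool (N (H t \<omega>) \<omega> = m)" for \<omega>
  have J: "J n \<in> borel_measurable M"
      "expectation (J n) = expectation (\<lambda>\<omega>. poisson_weight lam k (\<tau> n (H t \<omega>)))" for n
  proof -
    define F where "F z = (of_bool (snd z (\<tau> n (fst z t)) = real m) :: real)"
      for z :: "(real \<Rightarrow> real) \<times> (real \<Rightarrow> real)"
    have Fm: "F \<in> borel_measurable (S \<Otimes>\<^sub>M S)"
    proof -
      have [measurable]: "(\<lambda>z. fst z t) \<in> borel_measurable (S \<Otimes>\<^sub>M S)"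
        using measurable_compose[OF measurable_fst comp[OF t]] .
      have [measurable]: "(\<lambda>z. snd z ((real i + 1) / real (Suc n))) \<in> borel_measurable (S \<Otimes>\<^sub>M S)" for i
        by (rule measurable_compose[OF measurable_snd comp]) simp
      \<comment> \<open>The evaluation time takes only countably many values, and this makes
        evaluation at a random time measurable for the product sigma-algebra.\<close>
      have "(\<lambda>z. (\<lambda>i z. of_bool (snd z ((real i + 1) / real (Suc n)) = real m) :: real)
          (nat \<lfloor>real (Suc n) * fst z t\<rfloor>) z) \<in> borel_measurable (S \<Otimes>\<^sub>M S)"
        by (rule measurable_compose_countable) measurable
      then show ?thesis by (simp add: F_def[abs_def] \<tau>_def)
    qed
    \<comment> \<open>Two sample points are kept apart: \<open>\<omega>\<close> drives the hitting
      time, \<open>\<omega>'\<close> the Poisson path.\<close>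
    have F_J: "F (?U \<omega>, ?V \<omega>') = of_bool (N (\<tau> n (H t \<omega>)) \<omega>' = m)" for \<omega> \<omega>'
      using t \<tau>_nonneg by (simp add: F_def)
    then have J_F: "J n = (\<lambda>\<omega>. F (?U \<omega>, ?V \<omega>))" by (simp add: J_def fun_eq_iff)
    show "J n \<in> borel_measurable M"
      unfolding J_F
      by (rule measurable_compose[OF measurable_Pair[OF indep_var_rv1[OF UV] indep_var_rv2[OF UV]] Fm])
    have "expectation (J n) = expectation (\<lambda>\<omega>. expectation (\<lambda>\<omega>'. F (?U \<omega>, ?V \<omega>')))"
      unfolding J_F by (rule expectation_indep_pair[OF UV Fm, of 1]) (simp add: F_def)
    also have "\<dots> = expectation (\<lambda>\<omega>. poisson_weight lam k (\<tau> n (H t \<omega>)))"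
    proof (intro Bochner_Integration.integral_cong refl)
      fix \<omega>
      let ?s = "\<tau> n (H t \<omega>)"
      have [measurable]: "N ?s \<in> measurable M (count_space UNIV)"
        using N \<tau>_nonneg unfolding poisson_process_def by blast
      have "expectation (\<lambda>\<omega>'. F (?U \<omega>, ?V \<omega>'))
          = expectation (indicator {\<omega> \<in> space M. N ?s \<omega> = m})"
        unfolding F_J by (intro Bochner_Integration.integral_cong) auto
      also have "\<dots> = poisson_prob N m ?s"
        by (simp add: poisson_prob_def)
      finally show "expectation (\<lambda>\<omega>'. F (?U \<omega>, ?V \<omega>')) = poisson_weight lam k ?s"
        using poisson_prob_eq[OF N lam \<tau>_nonneg] by (simp add: k)
    qed
    finally show "expectation (J n) = expectation (\<lambda>\<omega>. poisson_weight lam k (\<tau> n (H t \<omega>)))" .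
  qed
  note [measurable] = J(1)
  have J_L: "(\<lambda>n. J n \<omega>) \<longlonglongrightarrow> L \<omega>" if \<omega>: "\<omega> \<in> space M" for \<omega>
  proof -
    have "((\<lambda>s. N s \<omega>) \<longlongrightarrow> N (H t \<omega>) \<omega>) (at_right (H t \<omega>))"
      using cont[OF \<omega> H[OF \<omega>]] by (simp add: continuous_within)
    \<comment> \<open>The paths take values in a discrete space, so convergence means eventual
      equality.\<close>
    from filterlim_compose[OF this \<tau>_lim[OF \<omega>]]
    have "\<forall>\<^sub>F n in sequentially. N (\<tau> n (H t \<omega>)) \<omega> = N (H t \<omega>) \<omega>"
      by (simp add: tendsto_discrete)
    then show ?thesis
      by (intro tendsto_eventually) (auto elim!: eventually_mono simp: J_def L_def)
  qed
  have [measurable]: "L \<in> borel_measurable M"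
    by (rule borel_measurable_LIMSEQ_real[OF J_L]) measurable
  have "norm (J n \<omega>) \<le> 1" for n \<omega> by (simp add: J_def)
  then have 1: "(\<lambda>n. expectation (J n)) \<longlonglongrightarrow> expectation L"
    by (intro integral_dominated_convergence[where w = "\<lambda>_. 1"]) (auto intro!: AE_I2 J_L)
  have 2: "(\<lambda>n. expectation (J n)) \<longlonglongrightarrow> expectation (\<lambda>\<omega>. poisson_weight lam k (H t \<omega>))"
    unfolding J(2)
  proof (rule integral_dominated_convergence[where w = "\<lambda>_. 1"])
    show "AE \<omega> in M. (\<lambda>n. poisson_weight lam k (\<tau> n (H t \<omega>))) \<longlonglongrightarrow> poisson_weight lam k (H t \<omega>)"
    proof (rule AE_I2)
      fix \<omega> assume "\<omega> \<in> space M"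
      then have "(\<lambda>n. \<tau> n (H t \<omega>)) \<longlonglongrightarrow> H t \<omega>"
        using \<tau>_lim unfolding filterlim_at by blast
      then show "(\<lambda>n. poisson_weight lam k (\<tau> n (H t \<omega>))) \<longlonglongrightarrow> poisson_weight lam k (H t \<omega>)"
        by (rule isCont_tendsto_compose[OF isCont_poisson_weight])
    qed
    show "AE \<omega> in M. norm (poisson_weight lam k (\<tau> n (H t \<omega>))) \<le> 1" for n
      using poisson_weight_bounds[OF lam \<tau>_nonneg] by (intro AE_I2) simp
  qed auto
  have "{\<omega> \<in> space M. N (H t \<omega>) \<omega> = m} = {\<omega> \<in> space M. L \<omega> = 1}" by (auto simp: L_def)
  then have [measurable]: "{\<omega> \<in> space M. N (H t \<omega>) \<omega> = m} \<in> events" by simp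
  have "expectation L = expectation (indicator {\<omega> \<in> space M. N (H t \<omega>) \<omega> = m})"
    by (intro Bochner_Integration.integral_cong) (auto simp: L_def)
  also have "\<dots> = subordinated_prob N H k t"
    by (simp add: subordinated_prob_def k)
  finally show ?thesis using LIMSEQ_unique[OF 1 2] by simp
qed

end

section \<open>The governing equation\<close>

theorem proposition2p2:
  fixes M :: "'a measure"
    and B :: "real \<Rightarrow> 'a \<Rightarrow> real" and N :: "real \<Rightarrow> 'a \<Rightarrow> nat" and H :: "real \<Rightarrow> 'a \<Rightarrow> real"
    and h :: "real \<Rightarrow> real \<Rightarrow> real"
    and lam \<delta> \<gamma> t :: real and k :: nat
  defines "H \<equiv> first_hitting_time (inverse_gaussian_subordinator \<delta> \<gamma> B)"
  defines "p \<equiv> prob_space.subordinated_prob M N H"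
  assumes "prob_space M"
    and "lam > 0" and "\<delta> > 0" and "\<gamma> \<ge> 0"
    and "prob_space.poisson_process M lam N"
    and "prob_space.standard_brownian_motion M B"
    and "prob_space.indep_processes M H (\<lambda>x \<omega>. real (N x \<omega>))"
    and "\<And>t. t > 0 \<Longrightarrow> prob_space.has_continuous_density_on_pos M (H t) (\<lambda>x. h x t)"
    and "t > 0"
  shows "\<exists>h0 dp0.
      ((\<lambda>x. h x t) \<longlongrightarrow> h0) (at_right 0) \<and>
      (prob_space.poisson_prob M N k has_real_derivative dp0) (at 0 within {0..}) \<and>
      dp0 = (if k = 0 then - lam else if k = 1 then lam else 0) \<and>
      (p (int k) has_real_derivative
         1 / (2 * \<delta>\<^sup>2) *
           ((lam\<^sup>2 - 2 * \<delta> * \<gamma> * lam) * p (int k) t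
            + (- 2 * lam\<^sup>2 + 2 * \<delta> * \<gamma> * lam) * p (int k - 1) t
            + lam\<^sup>2 * p (int k - 2) t)
         - dirac_delta0 t * p (int k) 0
         + 1 / (2 * \<delta>\<^sup>2) * h0 * dp0) (at t)"
proof -
  interpret prob_space M by fact
  note lam = \<open>lam > 0\<close> and \<delta> = \<open>\<delta> > 0\<close> and \<gamma> = \<open>\<gamma> \<ge> 0\<close> and t = \<open>t > 0\<close>
    and N = \<open>poisson_process lam N\<close> and B = \<open>standard_brownian_motion B\<close>
    and ind = \<open>indep_processes H (\<lambda>x \<omega>. real (N x \<omega>))\<close>
    and dens = \<open>\<And>t. t > 0 \<Longrightarrow> has_continuous_density_on_pos (H t) (\<lambda>x. h x t)\<close>
  let ?\<phi> = "poisson_weight lam" and ?q = "hitting_density \<delta> \<gamma>"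
  have h_eq: "h x s = ?q x s" if "0 < s" "0 < x" for s x
    using continuous_density_eq_hitting_density[OF B \<gamma> \<delta> that] dens[OF that(1)] unfolding H_def by blast
  have p_eq: "p j s = (LINT x:{0<..}|lborel. ?\<phi> j x * ?q x s)" if s: "0 < s" for j s
  proof -
    have D: "distributed M lborel (H s) (\<lambda>x. ennreal (indicator {0<..} x * h x s))"
      and h0: "\<And>x. 0 < x \<Longrightarrow> 0 \<le> h x s"
      using dens[OF s] unfolding has_continuous_density_on_pos_def by auto
    have "0 \<le> H s \<omega>" if "\<omega> \<in> space M" for \<omega>
      unfolding H_def using B \<delta> s that unfolding standard_brownian_motion_def
      by (intro first_hitting_time_nonneg) auto
    then have "p j s = expectation (\<lambda>\<omega>. ?\<phi> j (H s \<omega>))"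
      unfolding p_def using s by (intro subordinated_prob_eq_expectation[OF N lam _ ind]) auto
    also have "\<dots> = (\<integral>x. (indicator {0<..} x * h x s) * ?\<phi> j x \<partial>lborel)"
      by (rule distributed_integral[OF D, symmetric]) (use h0 in \<open>auto simp: indicator_def\<close>)
    also have "\<dots> = (LINT x:{0<..}|lborel. ?\<phi> j x * ?q x s)"
      unfolding set_lebesgue_integral_def
      by (intro Bochner_Integration.integral_cong refl) (auto simp: indicator_def h_eq[OF s])
    finally show ?thesis .
  qed
  define d1 where "d1 x = lam * (?\<phi> (int k - 1) x - ?\<phi> (int k) x)" for x
  \<comment> \<open>The second difference of the weights in the index, times
    \<open>lam\<^sup>2\<close>. Adding \<open>2 * \<delta> * \<gamma> * d1 x\<close> produces the
    coefficients of the equation.\<close>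
  define d2 where "d2 x = lam\<^sup>2 * ?\<phi> (int k) x - 2 * lam\<^sup>2 * ?\<phi> (int k - 1) x + lam\<^sup>2 * ?\<phi> (int k - 2) x" for x
  have D1: "(?\<phi> (int k) has_real_derivative d1 x) (at x)" for x
    unfolding d1_def by (rule DERIV_poisson_weight)
  have D2: "(d1 has_real_derivative d2 x) (at x)" for x
  proof -
    have "(d1 has_real_derivative lam * (lam * (?\<phi> (int k - 1 - 1) x - ?\<phi> (int k - 1) x)
        - lam * (?\<phi> (int k - 1) x - ?\<phi> (int k) x))) (at x)"
      unfolding d1_def by (intro DERIV_cmult DERIV_diff DERIV_poisson_weight)
    then show ?thesis
      by (rule DERIV_cong) (simp add: d2_def algebra_simps power2_eq_square)
  qed
  have int\<phi>: "set_integrable lborel {0<..} (?\<phi> j)" for j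
    by (rule set_integrable_poisson_weight[OF lam])
  have int1: "set_integrable lborel {0<..} d1" and int2: "set_integrable lborel {0<..} d2"
    unfolding d1_def d2_def using int\<phi> by (intro set_integral_add set_integral_diff set_integrable_mult_right; simp)+
  have lim1: "(d1 \<longlongrightarrow> 0) at_top"
    unfolding d1_def using tendsto_diff[OF poisson_weight_at_top[OF lam] poisson_weight_at_top[OF lam]]
    by (intro tendsto_mult_right_zero) simp
  have cont2: "isCont d2 x" for x
    unfolding d2_def by (intro continuous_intros isCont_poisson_weight)
  have int\<phi>q: "set_integrable lborel {0<..} (\<lambda>x. ?\<phi> j x * ?q x t)" for j
  proof (rule set_integrable_mult_bounded[OF int\<phi>])
    show "(\<lambda>x. ?q x t) \<in> borel_measurable borel"
      by (intro borel_measurable_continuous_onI continuous_at_imp_continuous_on ballI isCont_hitting_density t)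
    show "\<bar>?q x t\<bar> \<le> \<delta> * (2 / sqrt t)" if "x \<in> {0<..}" for x
      using that by (intro hitting_density_bounded t \<gamma> \<delta>) simp
  qed simp
  have p1: "(LINT x:{0<..}|lborel. d1 x * ?q x t) = lam * (p (int k - 1) t - p (int k) t)"
    by (simp add: d1_def p_eq[OF t] mult.assoc left_diff_distrib int\<phi>q)
  have p2: "(LINT x:{0<..}|lborel. d2 x * ?q x t)
      = lam\<^sup>2 * p (int k) t - 2 * lam\<^sup>2 * p (int k - 1) t + lam\<^sup>2 * p (int k - 2) t"
    by (simp add: d2_def p_eq[OF t] mult.assoc left_diff_distrib distrib_right int\<phi>q)
  \<comment> \<open>The integral represents \<open>p\<close> at positive times, hence the transfer
    of the derivative on the open half-line around \<open>t\<close>.\<close>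
  have "(p (int k) has_real_derivative
      1 / (2 * \<delta>\<^sup>2) * ((LINT x:{0<..}|lborel. d2 x * ?q x t)
        + 2 * \<delta> * \<gamma> * (LINT x:{0<..}|lborel. d1 x * ?q x t) + d1 0 * ?q 0 t)) (at t)"
    by (rule has_field_derivative_transform_within_open[where S = "{0<..}",
          OF DERIV_integral_hitting_density[OF t \<gamma> \<delta> D1 D2 cont2 int\<phi> int1 int2 poisson_weight_at_top[OF lam] lim1]])
       (use t in \<open>simp_all add: p_eq\<close>)
  then have "(p (int k) has_real_derivative
         1 / (2 * \<delta>\<^sup>2) *
           ((lam\<^sup>2 - 2 * \<delta> * \<gamma> * lam) * p (int k) t
            + (- 2 * lam\<^sup>2 + 2 * \<delta> * \<gamma> * lam) * p (int k - 1) t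
            + lam\<^sup>2 * p (int k - 2) t)
         - dirac_delta0 t * p (int k) 0
         + 1 / (2 * \<delta>\<^sup>2) * ?q 0 t * d1 0) (at t)"
    by (rule DERIV_cong) (use t in \<open>simp add: p1 p2 dirac_delta0_def algebra_simps\<close>)
  moreover have "((\<lambda>x. h x t) \<longlongrightarrow> ?q 0 t) (at_right 0)"
  proof -
    have "((\<lambda>x. ?q x t) \<longlongrightarrow> ?q 0 t) (at_right 0)"
      using isCont_hitting_density[OF t, where x = 0 and \<delta> = \<delta> and \<gamma> = \<gamma>] by (simp add: isCont_def filterlim_at_split)
    moreover have "\<forall>\<^sub>F x in at_right 0. ?q x t = h x t"
      by (rule eventually_mono[OF eventually_at_right_less]) (simp add: h_eq t)
    ultimately show ?thesis by (rule Lim_transform_eventually)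
  qed
  \<comment> \<open>The probability is identified with the smooth weight from 0 onwards, so the
    derivative at 0 is one-sided.\<close>
  moreover have "(poisson_prob N k has_real_derivative d1 0) (at 0 within {0..})"
    by (rule has_field_derivative_transform_within[OF has_field_derivative_at_within[OF D1], of 1])
       (auto simp: poisson_prob_eq[OF N lam])
  moreover have "d1 0 = (if k = 0 then - lam else if k = 1 then lam else 0)"
    by (auto simp: d1_def poisson_weight_def power_0_left)
  ultimately show ?thesis by blast
qed

end
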